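(* Let $M$ be a commutative monoid and let $\mathcal V$ be the semigroup variety generated by $M$. Then $\mathcal V$ is definable in the lattice $\mathbf{Com}$: there is a first-order formula $\Phi(x)$ with one free variable in the language $\{\vee,\wedge\}$ such that, for every commutative semigroup variety $\mathcal X$, $\Phi(\mathcal X)$ holds in $\mathbf{Com}$ if and only if $\mathcal X=\mathcal V$.
   Context: $\mathbf{Com}$ denotes the lattice of all commutative semigroup varieties, ordered by inclusion, with join $\vee$ and meet $\wedge$. A subset $A$ of a lattice $L$ (or a single element) is definable in $L$ if there is a first-order formula $\Phi(x)$ with one free variable in the language of the lattice operations $\vee,\wedge$ such that for $a\in L$, $\Phi(a)$ is true in $L$ iff $a\in A$. *)

theory Defs
  imports "HOL-Library.Multiset"
begin

text \<open>Elements of the free commutative semigroup over countably many variables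
  (indexed by nat) are nonempty finite multisets of variables.
  An identity is a pair of such words.\<close>

definition cwords :: "nat multiset set" where
  "cwords = {s. s \<noteq> {#}}"

definition subst_word :: "(nat \<Rightarrow> nat multiset) \<Rightarrow> nat multiset \<Rightarrow> nat multiset" where
  "subst_word \<sigma> s = sum_mset (image_mset \<sigma> s)"

text \<open>Equational theories of commutative semigroup varieties = fully invariant
  congruences on the free commutative semigroup of countable rank.\<close>
definition fully_invariant_congruence :: "(nat multiset \<times> nat multiset) set \<Rightarrow> bool" where
  "fully_invariant_congruence T \<longleftrightarrow>
     T \<subseteq> cwords \<times> cwords \<and>
     (\<forall>s\<in>cwords. (s, s) \<in> T) \<and>
     (\<forall>s t. (s, t) \<in> T \<longrightarrow> (t, s) \<in> T) \<and>
     (\<forall>s t u. (s, t) \<in> T \<longrightarrow> (t, u) \<in> T \<longrightarrow> (s, u) \<in> T) \<and>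
     (\<forall>s t u. (s, t) \<in> T \<longrightarrow> u \<in> cwords \<longrightarrow> (s + u, t + u) \<in> T) \<and>
     (\<forall>\<sigma> s t. (\<forall>x. \<sigma> x \<in> cwords) \<longrightarrow> (s, t) \<in> T \<longrightarrow>
                 (subst_word \<sigma> s, subst_word \<sigma> t) \<in> T)"

text \<open>A commutative semigroup variety is represented by its equational theory
  (Birkhoff). Inclusion of varieties is reverse inclusion of theories, hence
  the join of varieties is the intersection of theories and the meet of varieties
  is the least equational theory containing both theories.\<close>

definition Com :: "(nat multiset \<times> nat multiset) set set" where
  "Com = {T. fully_invariant_congruence T}"

definition Com_join :: "(nat multiset \<times> nat multiset) set \<Rightarrow> (nat multiset \<times> nat multiset) set
    \<Rightarrow> (nat multiset \<times> nat multiset) set" where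
  "Com_join T1 T2 = T1 \<inter> T2"

definition Com_meet :: "(nat multiset \<times> nat multiset) set \<Rightarrow> (nat multiset \<times> nat multiset) set
    \<Rightarrow> (nat multiset \<times> nat multiset) set" where
  "Com_meet T1 T2 = \<Inter>{T. fully_invariant_congruence T \<and> T1 \<union> T2 \<subseteq> T}"

text \<open>The (semigroup) variety generated by a commutative monoid, given as the
  carrier type 'a with its multiplication: its equational theory is the set of
  semigroup identities holding in the monoid.\<close>
definition variety_generated :: "('a::comm_monoid_mult) itself \<Rightarrow> (nat multiset \<times> nat multiset) set" where
  "variety_generated _ = {(s, t). s \<in> cwords \<and> t \<in> cwords \<and>
      (\<forall>v::nat \<Rightarrow> 'a. prod_mset (image_mset v s) = prod_mset (image_mset v t))}"

datatype lterm = LVar nat | LJoin lterm lterm | LMeet lterm lterm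

datatype lform = LEq lterm lterm | LNot lform | LAnd lform lform | LOr lform lform
  | LEx nat lform | LAll nat lform

fun eval_lterm :: "('b \<Rightarrow> 'b \<Rightarrow> 'b) \<Rightarrow> ('b \<Rightarrow> 'b \<Rightarrow> 'b) \<Rightarrow> (nat \<Rightarrow> 'b) \<Rightarrow> lterm \<Rightarrow> 'b" where
  "eval_lterm j m e (LVar n) = e n"
| "eval_lterm j m e (LJoin a b) = j (eval_lterm j m e a) (eval_lterm j m e b)"
| "eval_lterm j m e (LMeet a b) = m (eval_lterm j m e a) (eval_lterm j m e b)"

fun sat :: "'b set \<Rightarrow> ('b \<Rightarrow> 'b \<Rightarrow> 'b) \<Rightarrow> ('b \<Rightarrow> 'b \<Rightarrow> 'b) \<Rightarrow> (nat \<Rightarrow> 'b) \<Rightarrow> lform \<Rightarrow> bool" where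
  "sat L j m e (LEq a b) \<longleftrightarrow> eval_lterm j m e a = eval_lterm j m e b"
| "sat L j m e (LNot f) \<longleftrightarrow> \<not> sat L j m e f"
| "sat L j m e (LAnd f g) \<longleftrightarrow> sat L j m e f \<and> sat L j m e g"
| "sat L j m e (LOr f g) \<longleftrightarrow> sat L j m e f \<or> sat L j m e g"
| "sat L j m e (LEx n f) \<longleftrightarrow> (\<exists>x\<in>L. sat L j m (e(n := x)) f)"
| "sat L j m e (LAll n f) \<longleftrightarrow> (\<forall>x\<in>L. sat L j m (e(n := x)) f)"

fun tvars :: "lterm \<Rightarrow> nat set" where
  "tvars (LVar n) = {n}"
| "tvars (LJoin a b) = tvars a \<union> tvars b"
| "tvars (LMeet a b) = tvars a \<union> tvars b"

fun fvars :: "lform \<Rightarrow> nat set" where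
  "fvars (LEq a b) = tvars a \<union> tvars b"
| "fvars (LNot f) = fvars f"
| "fvars (LAnd f g) = fvars f \<union> fvars g"
| "fvars (LOr f g) = fvars f \<union> fvars g"
| "fvars (LEx n f) = fvars f - {n}"
| "fvars (LAll n f) = fvars f - {n}"

definition definable :: "'b set \<Rightarrow> ('b \<Rightarrow> 'b \<Rightarrow> 'b) \<Rightarrow> ('b \<Rightarrow> 'b \<Rightarrow> 'b) \<Rightarrow> 'b set \<Rightarrow> bool" where
  "definable L j m A \<longleftrightarrow>
     (\<exists>\<Phi>. fvars \<Phi> \<subseteq> {0} \<and> (\<forall>x\<in>L. sat L j m (\<lambda>_. x) \<Phi> \<longleftrightarrow> x \<in> A))"

end

theory Submission
  imports Defs
begin

text \<open>
  A commutative monoid satisfies a semigroup identity iff it satisfies \<open>x\<^sup>i = x\<^sup>j\<close> for the exponents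
  \<open>i, j\<close> of every variable on the two sides. Hence it generates the variety of all commutative
  semigroups, or that of abelian groups of exponent \<open>m\<close>, or the variety given by \<open>x\<^sup>n = x\<^bsup>n+m\<^esup>\<close>
  with \<open>n \<ge> 1\<close>.

  The variety \<open>x\<^sup>2 = 0\<close> is the only nontrivial one whose subvarieties form a chain and which has no
  maximal proper subvariety. The \<open>n\<close>-th member of this chain is \<open>R\<^sub>n\<close>, given by
  \<open>x\<^sup>2 = x\<^sub>1\<dots>x\<^sub>n = 0\<close>. A variety is completely regular (\<open>x = x\<^bsup>1+c\<^esup>\<close>) iff it does not contain
  \<open>R\<^sub>2\<close>, it is nil iff its completely regular subvarieties are trivial, and the variety \<open>P\<^sub>n\<close> of
  \<open>x\<^sub>1\<dots>x\<^sub>n = 0\<close> is the largest nil variety not containing \<open>R\<^bsub>n+1\<^esub>\<close>.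

  Joining with a group variety of large exponent destroys the balanced identities between short
  words, but not the existence of an identity \<open>x\<^sup>n = x\<^bsup>n+r\<^esup>\<close>. So \<open>V\<close> has index at most \<open>n\<close> iff
  \<open>P\<^bsub>n+1\<^esub> \<le> V \<or> G\<close> for no completely regular \<open>G\<close>. The period of a completely regular \<open>G\<close> is at
  most \<open>k - 2\<close> iff \<open>P\<^bsub>k+1\<^esub> \<le> V \<or> G\<close> fails for some \<open>V\<close> of index greater than \<open>k\<close>: the extreme case is
  the identity \<open>x\<^bsup>k-1\<^esup> y = x y\<^bsup>k-1\<^esup>\<close>, whose exponents differ by \<open>k - 2\<close>. Thus index and period are
  definable, and with them the varieties above.
\<close>

section \<open>Words and fully invariant congruences\<close>

abbreviation fic :: "(nat multiset \<times> nat multiset) set \<Rightarrow> bool" where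
  "fic \<equiv> fully_invariant_congruence"

lemma repeat_mset_Suc: "repeat_mset (Suc k) s = s + repeat_mset k s"
  by (rule multiset_eqI) simp

lemma repeat_mset_replicate: "repeat_mset i (replicate_mset j x) = replicate_mset (i * j) x"
  by (rule multiset_eqI) simp

lemma repeat_mset_single: "repeat_mset i {#x#} = replicate_mset i x"
  by (rule multiset_eqI) simp

lemma replicate_mset_plus: "replicate_mset (i + j) x = replicate_mset i x + replicate_mset j x"
  by (rule multiset_eqI) simp

lemma repeat_mset_empty_iff: "repeat_mset k s = {#} \<longleftrightarrow> k = 0 \<or> s = {#}"
  by (induction k) (auto simp: repeat_mset_Suc)

lemma subst_word_simps [simp]:
  "subst_word \<sigma> {#} = {#}"
  "subst_word \<sigma> (add_mset x s) = \<sigma> x + subst_word \<sigma> s"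
  "subst_word \<sigma> (s + t) = subst_word \<sigma> s + subst_word \<sigma> t"
  by (simp_all add: subst_word_def)

lemma subst_word_repeat [simp]: "subst_word \<sigma> (repeat_mset k s) = repeat_mset k (subst_word \<sigma> s)"
  by (induction k) (simp_all add: repeat_mset_Suc)

lemma subst_word_replicate [simp]: "subst_word \<sigma> (replicate_mset k x) = repeat_mset k (\<sigma> x)"
  by (induction k) (simp_all add: repeat_mset_Suc)

lemma subst_word_nonempty:
  assumes "\<And>x. \<sigma> x \<noteq> {#}" "s \<noteq> {#}" shows "subst_word \<sigma> s \<noteq> {#}"
  using assms by (cases s) auto

lemma subst_word_cong:
  assumes "\<And>x. x \<in># s \<Longrightarrow> \<sigma> x = \<tau> x" shows "subst_word \<sigma> s = subst_word \<tau> s"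
  unfolding subst_word_def using assms by (metis image_mset_cong)

lemma subst_word_id: "subst_word (\<lambda>x. {#x#}) s = s"
  by (induction s) auto

lemma size_subst_word:
  assumes "\<And>x. \<sigma> x \<noteq> {#}" shows "size s \<le> size (subst_word \<sigma> s)"
proof (induction s)
  case (add x s)
  have "size (\<sigma> x) \<ge> 1" using assms[of x] by (simp add: Suc_le_eq nonempty_has_size)
  then show ?case using add by (simp del: size_eq_0_iff_empty)
qed simp

lemma set_subst_word: "set_mset (subst_word \<sigma> s) = (\<Union>x\<in>set_mset s. set_mset (\<sigma> x))"
  by (induction s) auto

text \<open>Keeping one variable apart and merging all others turns an arbitrary identity into one
  in two letters, governed only by \<open>count s x\<close> and the remaining length.\<close>

lemma subst_word_two:
  "subst_word (\<lambda>y. if y = x then U else W) s =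
     repeat_mset (count s x) U + repeat_mset (size {#y \<in># s. y \<noteq> x#}) W"
  by (induction s) (auto simp: repeat_mset_Suc)

lemma size_split: "size s = count s x + size {#y \<in># s. y \<noteq> x#}"
  by (induction s) auto

context
  fixes T assumes T: "fic T"
begin

lemma fic_ne: "(s, t) \<in> T \<Longrightarrow> s \<noteq> {#} \<and> t \<noteq> {#}"
  using T unfolding fully_invariant_congruence_def cwords_def by blast

lemma fic_refl: "s \<noteq> {#} \<Longrightarrow> (s, s) \<in> T"
  using T unfolding fully_invariant_congruence_def cwords_def by blast

lemma fic_sym: "(s, t) \<in> T \<Longrightarrow> (t, s) \<in> T"
  using T unfolding fully_invariant_congruence_def by blast

lemma fic_trans: "(s, t) \<in> T \<Longrightarrow> (t, u) \<in> T \<Longrightarrow> (s, u) \<in> T"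
  using T unfolding fully_invariant_congruence_def by blast

lemma fic_add: "(s, t) \<in> T \<Longrightarrow> (s + u, t + u) \<in> T"
proof (cases "u = {#}")
  case False
  have "\<forall>s t u. (s, t) \<in> T \<longrightarrow> u \<in> cwords \<longrightarrow> (s + u, t + u) \<in> T"
    using T unfolding fully_invariant_congruence_def by (elim conjE)
  then show "(s, t) \<in> T \<Longrightarrow> (s + u, t + u) \<in> T" using False by (simp add: cwords_def)
qed simp

lemma fic_add_left: "(s, t) \<in> T \<Longrightarrow> (u + s, u + t) \<in> T"
  using fic_add[of s t u] by (simp add: add.commute)

lemma fic_plus: "(s, t) \<in> T \<Longrightarrow> (s', t') \<in> T \<Longrightarrow> (s + s', t + t') \<in> T"
  using fic_add[of s t s'] fic_add_left[of s' t' t] fic_trans by blast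

lemma fic_subst: "(s, t) \<in> T \<Longrightarrow> (\<And>x. \<sigma> x \<noteq> {#}) \<Longrightarrow> (subst_word \<sigma> s, subst_word \<sigma> t) \<in> T"
proof -
  have "\<forall>\<sigma> s t. (\<forall>x. \<sigma> x \<in> cwords) \<longrightarrow> (s, t) \<in> T \<longrightarrow> (subst_word \<sigma> s, subst_word \<sigma> t) \<in> T"
    using T unfolding fully_invariant_congruence_def by (elim conjE)
  then show "(s, t) \<in> T \<Longrightarrow> (\<And>x. \<sigma> x \<noteq> {#}) \<Longrightarrow> (subst_word \<sigma> s, subst_word \<sigma> t) \<in> T"
    by (simp add: cwords_def)
qed

lemma fic_repeat: "(s, t) \<in> T \<Longrightarrow> k \<ge> 1 \<Longrightarrow> (repeat_mset k s, repeat_mset k t) \<in> T"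
proof (induction k)
  case (Suc k) then show ?case
    by (cases "k = 0") (simp_all add: repeat_mset_Suc fic_plus)
qed simp

end

lemma ficI:
  assumes "\<And>s t. (s, t) \<in> T \<Longrightarrow> s \<noteq> {#} \<and> t \<noteq> {#}"
    and "\<And>s. s \<noteq> {#} \<Longrightarrow> (s, s) \<in> T"
    and "\<And>s t. (s, t) \<in> T \<Longrightarrow> (t, s) \<in> T"
    and "\<And>s t u. (s, t) \<in> T \<Longrightarrow> (t, u) \<in> T \<Longrightarrow> (s, u) \<in> T"
    and "\<And>s t u. (s, t) \<in> T \<Longrightarrow> u \<noteq> {#} \<Longrightarrow> (s + u, t + u) \<in> T"
    and "\<And>\<sigma> s t. (\<And>x. \<sigma> x \<noteq> {#}) \<Longrightarrow> (s, t) \<in> T \<Longrightarrow> (subst_word \<sigma> s, subst_word \<sigma> t) \<in> T"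
  shows "fic T"
  unfolding fully_invariant_congruence_def cwords_def
  apply (intro conjI ballI allI impI)
  subgoal using assms(1) by auto
  subgoal using assms(2) by blast
  subgoal using assms(3) by blast
  subgoal using assms(4) by blast
  subgoal using assms(5) by simp
  subgoal using assms(6) by simp
  done

lemma fic_full: "fic (cwords \<times> cwords)"
  by (rule ficI) (auto simp: cwords_def subst_word_nonempty)

lemma fic_subset_full: "fic T \<Longrightarrow> T \<subseteq> cwords \<times> cwords"
  by (simp add: fully_invariant_congruence_def)

lemma fic_Int: "fic S \<Longrightarrow> fic T \<Longrightarrow> fic (S \<inter> T)"
  apply (rule ficI)
  subgoal using fic_ne by blast
  subgoal using fic_refl by blast
  subgoal using fic_sym by blast
  subgoal using fic_trans by blast
  subgoal using fic_add by simp
  subgoal using fic_subst by simp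
  done

lemma fic_full_if_vars:
  assumes T: "fic T" and "({#0#}, {#1#}) \<in> T" shows "T = cwords \<times> cwords"
proof -
  have "(u, v) \<in> T" if "u \<noteq> {#}" "v \<noteq> {#}" for u v
    using fic_subst[OF T assms(2), of "\<lambda>x. if x = 0 then u else v"] that by simp
  then show ?thesis using fic_subset_full[OF T] by (auto simp: cwords_def)
qed

text \<open>The exponents are corrected one variable at a time, by induction on the number of
  variables where \<open>s\<close> and \<open>t\<close> disagree. \<open>R\<close> stays abstract
  because it will be membership in a theory, membership after multiplication by a fixed word, and
  equality of values in a monoid.\<close>

lemma pointwise_congruence:
  fixes s t :: "'b multiset"
  assumes refl: "\<And>u. R u u" and trans: "\<And>u v w. R u v \<Longrightarrow> R v w \<Longrightarrow> R u w"
    and add: "\<And>u v w. R u v \<Longrightarrow> R (w + u) (w + v)"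
    and "\<And>x. R (replicate_mset (count s x) x) (replicate_mset (count t x) x)"
  shows "R s t"
  using assms(4)
proof (induction "card {x. count s x \<noteq> count t x}" arbitrary: s)
  case (0 s)
  have "finite {x. count s x \<noteq> count t x}"
    by (rule finite_subset[of _ "set_mset s \<union> set_mset t"]) (auto simp: not_in_iff)
  then have "s = t" using 0 by (auto intro: multiset_eqI)
  then show ?case using refl by simp
next
  case (Suc n s)
  then obtain x where x: "count s x \<noteq> count t x"
    by (metis (mono_tags, lifting) Collect_empty_eq card.empty nat.distinct(1))
  define w where "w = {#y \<in># s. y \<noteq> x#}"
  have s: "s = w + replicate_mset (count s x) x"
    by (rule multiset_eqI) (simp add: w_def)
  \<comment> \<open>\<open>s'\<close> has the exponent of \<open>t\<close> at \<open>x\<close> and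
    agrees with \<open>s\<close> elsewhere, so one disagreement is gone.\<close>
  define s' where "s' = w + replicate_mset (count t x) x"
  have c: "count s' y = (if y = x then count t x else count s y)" for y
    by (simp add: s'_def w_def)
  have "{x. count s x \<noteq> count t x} = insert x {x. count s' x \<noteq> count t x}"
    using x by (auto simp: c split: if_splits)
  moreover have "x \<notin> {x. count s' x \<noteq> count t x}" by (simp add: c)
  moreover have "finite {x. count s' x \<noteq> count t x}"
    by (rule finite_subset[of _ "set_mset s' \<union> set_mset t"]) (auto simp: not_in_iff)
  ultimately have "n = card {x. count s' x \<noteq> count t x}" using Suc(2) by simp
  then have "R s' t"
    by (rule Suc(1)) (use Suc(3) refl in \<open>auto simp: c\<close>)
  moreover have "R s s'" by (subst s) (simp add: s'_def add Suc(3))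
  ultimately show ?case using trans by blast
qed

section \<open>Identities in one variable\<close>

definition power_id :: "(nat multiset \<times> nat multiset) set \<Rightarrow> nat \<Rightarrow> nat \<Rightarrow> bool" where
  "power_id T i j \<longleftrightarrow> (replicate_mset i 0, replicate_mset j 0) \<in> T"

context
  fixes T assumes T: "fic T"
begin

lemma power_id_sym: "power_id T i j \<Longrightarrow> power_id T j i"
  unfolding power_id_def by (rule fic_sym[OF T])

lemma power_id_trans: "power_id T i j \<Longrightarrow> power_id T j k \<Longrightarrow> power_id T i k"
  unfolding power_id_def by (rule fic_trans[OF T])

lemma power_id_refl: "i \<ge> 1 \<Longrightarrow> power_id T i i"
  unfolding power_id_def by (rule fic_refl[OF T]) auto

lemma power_id_pos: "power_id T i j \<Longrightarrow> i \<ge> 1 \<and> j \<ge> 1"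
  unfolding power_id_def by (auto dest!: fic_ne[OF T] simp: Suc_le_eq)

lemma power_id_add: "power_id T i j \<Longrightarrow> power_id T (i + k) (j + k)"
  unfolding power_id_def using fic_add[OF T] by (metis replicate_mset_plus)

lemma power_id_shift:
  assumes "power_id T i (i + r)" "i \<le> l" shows "power_id T l (l + q * r)"
proof (induction q)
  case 0
  have "l \<ge> 1" using power_id_pos[OF assms(1)] assms(2) by simp
  then show ?case by (simp add: power_id_refl)
next
  case (Suc q)
  have "power_id T (i + (l - i + q * r)) (i + r + (l - i + q * r))"
    by (rule power_id_add[OF assms(1)])
  then have "power_id T (l + q * r) (l + Suc q * r)"
    using assms(2) by (simp add: algebra_simps)
  then show ?case using Suc power_id_trans by blast
qed

lemma power_id_instance: "power_id T i j \<Longrightarrow> w \<noteq> {#} \<Longrightarrow> (repeat_mset i w, repeat_mset j w) \<in> T"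
  using fic_subst[OF T, of "replicate_mset i 0" "replicate_mset j 0" "\<lambda>_. w"]
  by (simp add: power_id_def)

lemma power_id_replicate: "power_id T i j \<Longrightarrow> (replicate_mset i x, replicate_mset j x) \<in> T"
  using power_id_instance[of i j "{#x#}"] by (simp add: repeat_mset_single)

text \<open>Sending \<open>x\<close> to \<open>z^a\<close> and every other variable to
  \<open>z^b\<close> leaves an identity between powers of \<open>z\<close>. With
  \<open>a = b = 1\<close> it compares lengths, with \<open>a = 2\<close>, \<open>b = 1\<close> it
  detects the exponent of \<open>x\<close>, and with \<open>b\<close> a period it isolates that
  exponent modulo \<open>b\<close>.\<close>

lemma power_id_two:
  assumes "(s, t) \<in> T" "a \<ge> 1" "b \<ge> 1"
  shows "power_id T (count s x * a + size {#y \<in># s. y \<noteq> x#} * b)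
              (count t x * a + size {#y \<in># t. y \<noteq> x#} * b)"
  using fic_subst[OF T assms(1),
      of "\<lambda>y. if y = x then replicate_mset a 0 else replicate_mset b 0"] assms(2,3)
  by (simp add: subst_word_two power_id_def repeat_mset_replicate replicate_mset_plus)

lemma power_id_size: "(s, t) \<in> T \<Longrightarrow> power_id T (size s) (size t)"
  using power_id_two[of s t 1 1 0] size_split[of s 0] size_split[of t 0] by (simp del: neq0_conv)

lemma power_id_size_count: "(s, t) \<in> T \<Longrightarrow> power_id T (size s + count s x) (size t + count t x)"
  using power_id_two[of s t 2 1 x] size_split[of s x] size_split[of t x]
  by (simp add: mult_2_right algebra_simps)

text \<open>Either the sides differ in length, or they have equal length and some variable has
  different exponents; doubling that variable then makes the lengths differ.\<close>

lemma periodic: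
  assumes "(s, t) \<in> T" "s \<noteq> t" shows "\<exists>n r. n \<ge> 1 \<and> r \<ge> 1 \<and> power_id T n (n + r)"
proof -
  have less: ?thesis if "power_id T i j" "i < j" for i j
    by (rule exI[of _ i], rule exI[of _ "j - i"]) (use that power_id_pos[OF that(1)] in simp)
  have *: ?thesis if "power_id T i j" "i \<noteq> j" for i j
    using less[OF that(1)] less[OF power_id_sym[OF that(1)]] that(2) by (meson nat_neq_iff)
  obtain x where x: "count s x \<noteq> count t x" using assms(2) by (auto simp: multiset_eq_iff)
  show ?thesis
  proof (cases "size s = size t")
    case True then show ?thesis using *[OF power_id_size_count[OF assms(1), of x]] x by simp
  next
    case False then show ?thesis using *[OF power_id_size[OF assms(1)]] by simp
  qed
qed

end

text \<open>\<open>u \<mapsto> u\<^sup>c\<close> is an endomorphism commuting with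
  substitutions, so its preimage of a theory is again a theory.\<close>

definition root :: "nat \<Rightarrow> (nat multiset \<times> nat multiset) set \<Rightarrow> (nat multiset \<times> nat multiset) set" where
  "root c T = {(u, v). (repeat_mset c u, repeat_mset c v) \<in> T}"

lemma fic_root:
  assumes T: "fic T" and c: "c \<ge> 1" shows "fic (root c T)" "T \<subseteq> root c T"
proof -
  have ne: "repeat_mset c u \<noteq> {#} \<longleftrightarrow> u \<noteq> {#}" for u :: "nat multiset"
    using c by (auto simp: repeat_mset_empty_iff)
  show "fic (root c T)"
    unfolding root_def
    apply (rule ficI)
    subgoal using fic_ne[OF T] ne by blast
    subgoal using fic_refl[OF T] ne by blast
    subgoal using fic_sym[OF T] by blast
    subgoal using fic_trans[OF T] by blast
    subgoal using fic_add[OF T] by simp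
    subgoal for \<sigma> s t using fic_subst[OF T, of "repeat_mset c s" "repeat_mset c t" \<sigma>] by simp
    done
  show "T \<subseteq> root c T" using fic_repeat[OF T _ c] by (auto simp: root_def)
qed

lemma power_id_root: "power_id (root c T) i j \<longleftrightarrow> power_id T (c * i) (c * j)"
  by (simp add: power_id_def root_def repeat_mset_replicate)

section \<open>Completely regular theories\<close>

definition compl_reg :: "(nat multiset \<times> nat multiset) set \<Rightarrow> bool" where
  "compl_reg T \<longleftrightarrow> (\<exists>c\<ge>1. power_id T 1 (1 + c))"

text \<open>For \<open>m \<ge> 1\<close>, the identities of abelian groups of exponent dividing
  \<open>m\<close>. The factors \<open>p\<close>, \<open>q\<close> make invariance under
  substitutions immediate; \<open>abelian_iff\<close> recovers the congruence of exponents.\<close>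

definition abelian :: "nat \<Rightarrow> (nat multiset \<times> nat multiset) set" where
  "abelian m = {(s, t). s \<noteq> {#} \<and> t \<noteq> {#} \<and> (\<exists>p q. s + repeat_mset m p = t + repeat_mset m q)}"

lemma fic_abelian: "fic (abelian m)"
proof (rule ficI)
  fix s t u assume "(s, t) \<in> abelian m" "(t, u) \<in> abelian m"
  then obtain p q p' q' where *: "s \<noteq> {#}" "u \<noteq> {#}"
    "s + repeat_mset m p = t + repeat_mset m q" "t + repeat_mset m p' = u + repeat_mset m q'"
    by (auto simp: abelian_def)
  have "s + repeat_mset m (p + p') = (t + repeat_mset m p') + repeat_mset m q"
    using *(3) by (simp add: ac_simps)
  also have "\<dots> = u + repeat_mset m (q + q')" using *(4) by (simp add: ac_simps)
  finally show "(s, u) \<in> abelian m" using * unfolding abelian_def by blast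
next
  fix s t u :: "nat multiset" assume "(s, t) \<in> abelian m"
  then obtain p q where *: "s \<noteq> {#}" "t \<noteq> {#}" "s + repeat_mset m p = t + repeat_mset m q"
    by (auto simp: abelian_def)
  have "s + u + repeat_mset m p = t + u + repeat_mset m q"
    using *(3) by (metis add.assoc add.commute)
  then show "(s + u, t + u) \<in> abelian m" using * unfolding abelian_def by auto
next
  fix \<sigma> :: "nat \<Rightarrow> nat multiset" and s t assume \<sigma>: "\<And>x. \<sigma> x \<noteq> {#}" and "(s, t) \<in> abelian m"
  then obtain p q where *: "s \<noteq> {#}" "t \<noteq> {#}" "s + repeat_mset m p = t + repeat_mset m q"
    by (auto simp: abelian_def)
  have "subst_word \<sigma> s + repeat_mset m (subst_word \<sigma> p) = subst_word \<sigma> t + repeat_mset m (subst_word \<sigma> q)"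
    using arg_cong[OF *(3), of "subst_word \<sigma>"] by simp
  then show "(subst_word \<sigma> s, subst_word \<sigma> t) \<in> abelian m"
    using subst_word_nonempty[of \<sigma>] * \<sigma> unfolding abelian_def by blast
next
  fix s t assume "(s, t) \<in> abelian m" then show "(t, s) \<in> abelian m"
    unfolding abelian_def by (simp, metis)
qed (auto simp: abelian_def)

lemma abelian_iff:
  assumes "m \<ge> 1"
  shows "(s, t) \<in> abelian m \<longleftrightarrow> s \<noteq> {#} \<and> t \<noteq> {#} \<and> (\<forall>x. count s x mod m = count t x mod m)"
proof safe
  fix x assume "(s, t) \<in> abelian m"
  then obtain p q where "s + repeat_mset m p = t + repeat_mset m q" by (auto simp: abelian_def)
  then have "count (s + repeat_mset m p) x = count (t + repeat_mset m q) x" by simp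
  then have "count s x + m * count p x = count t x + m * count q x" by simp
  then show "count s x mod m = count t x mod m" by (metis mod_mult_self2)
next
  assume *: "s \<noteq> {#}" "t \<noteq> {#}" "\<forall>x. count s x mod m = count t x mod m"
  \<comment> \<open>The witnesses exchange quotients: \<open>p\<close> receives those of
    \<open>t\<close> and \<open>q\<close> those of \<open>s\<close>, so equal remainders give equal
    exponents.\<close>
  have "finite {x. 0 < count w x div m}" for w :: "nat multiset"
    by (rule finite_subset[OF _ finite_set_mset[of w]]) (auto intro: ccontr simp: not_in_iff)
  then have c: "count (Abs_multiset (\<lambda>x. count t x div m)) = (\<lambda>x. count t x div m)"
     "count (Abs_multiset (\<lambda>x. count s x div m)) = (\<lambda>x. count s x div m)"
    by (auto intro: count_Abs_multiset)
  have "s + repeat_mset m (Abs_multiset (\<lambda>x. count t x div m)) =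
        t + repeat_mset m (Abs_multiset (\<lambda>x. count s x div m))"
    by (rule multiset_eqI) (simp add: c, metis *(3) add.assoc add.commute mult_div_mod_eq)
  then show "(s, t) \<in> abelian m" using * unfolding abelian_def by blast
qed (auto dest: fic_ne[OF fic_abelian])

lemma power_id_abelian: "m \<ge> 1 \<Longrightarrow> power_id (abelian m) i j \<longleftrightarrow> i \<ge> 1 \<and> j \<ge> 1 \<and> i mod m = j mod m"
  by (auto simp: power_id_def abelian_iff)

lemma compl_reg_abelian: "m \<ge> 1 \<Longrightarrow> compl_reg (abelian m)"
  unfolding compl_reg_def by (rule exI[of _ m]) (auto simp: power_id_abelian mod_Suc)

text \<open>A letter \<open>x\<close> already present in \<open>s\<close> may be replaced by
  \<open>x^(1+m)\<close>, which contributes a factor \<open>x^m\<close>; this is done for the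
  letters of \<open>u\<close> in turn.\<close>

lemma compl_reg_absorb:
  assumes T: "fic T" and c: "power_id T 1 (1 + m)" and "set_mset u \<subseteq> set_mset s" "s \<noteq> {#}"
  shows "(s, s + repeat_mset m u) \<in> T"
  using assms(3)
proof (induction u)
  case empty then show ?case by (simp add: fic_refl[OF T assms(4)])
next
  case (add x u)
  then obtain s' where s': "s = add_mset x s'" by (auto dest: multi_member_split)
  have "({#x#}, replicate_mset (1 + m) x) \<in> T"
    using power_id_replicate[OF T c, of x] by simp
  then have "({#x#} + (s' + repeat_mset m u), replicate_mset (1 + m) x + (s' + repeat_mset m u)) \<in> T"
    by (rule fic_add[OF T])
  moreover have "{#x#} + (s' + repeat_mset m u) = s + repeat_mset m u" by (simp add: s')
  moreover have "replicate_mset (1 + m) x + (s' + repeat_mset m u) = s + repeat_mset m (add_mset x u)"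
    by (rule multiset_eqI) (simp add: s')
  ultimately show ?case using add fic_trans[OF T] by (metis insert_subset set_mset_add_mset_insert)
qed

text \<open>Here \<open>m\<close>-th powers are idempotent. Sending \<open>x\<close> to
  \<open>a = z^m\<close> and the other variables to \<open>b = y^m\<close> yields
  \<open>ab = b\<close>; exchanging the two letters yields \<open>ba = a\<close>, hence
  \<open>a = b\<close>.\<close>

lemma compl_reg_different_content:
  assumes T: "fic T" and c: "power_id T 1 (1 + m)" and m: "m \<ge> 1"
    and st: "(s, t) \<in> T" and x: "x \<in># s" "x \<notin># t"
  shows "(replicate_mset m 0, replicate_mset m 1) \<in> T"
proof -
  let ?a = "replicate_mset m (0::nat)" and ?b = "replicate_mset m (1::nat)"
  have red: "(repeat_mset (Suc k) (replicate_mset m y), replicate_mset m y) \<in> T" for k and y :: nat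
  proof -
    have "(replicate_mset m y, replicate_mset m y + repeat_mset m (replicate_mset k y)) \<in> T"
      by (rule compl_reg_absorb[OF T c]) (use m in auto)
    then show ?thesis using fic_sym[OF T]
      by (simp add: repeat_mset_Suc repeat_mset_replicate replicate_mset_plus mult.commute)
  qed
  define a where "a = count s x - 1"
  define b where "b = size {#y \<in># s. y \<noteq> x#}"
  have cs: "count s x = Suc a" using x(1) by (simp add: a_def)
  have ct: "count t x = 0" using x(2) by (simp add: not_in_iff)
  define d where "d = size {#y \<in># t. y \<noteq> x#}"
  have "(repeat_mset (Suc a) ?a + repeat_mset b ?b, repeat_mset d ?b) \<in> T"
    using fic_subst[OF T st, of "\<lambda>y. if y = x then ?a else ?b"] m
    by (simp add: subst_word_two b_def d_def cs ct)
  \<comment> \<open>The extra \<open>?b\<close> guarantees a positive exponent even if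
    \<open>x\<close> is the only letter of \<open>s\<close>, so that \<open>red\<close>
    applies.\<close>
  then have "(repeat_mset (Suc a) ?a + repeat_mset b ?b + ?b, repeat_mset d ?b + ?b) \<in> T"
    by (rule fic_add[OF T])
  then have "(repeat_mset (Suc a) ?a + repeat_mset (Suc b) ?b, repeat_mset (Suc d) ?b) \<in> T"
    by (simp add: repeat_mset_Suc ac_simps)
  then have abelian: "(?a + ?b, ?b) \<in> T"
    using fic_plus[OF T red[of a 0] red[of b 1]] red[of d 1] fic_sym[OF T] fic_trans[OF T] by blast
  have "(?b + ?a, ?a) \<in> T"
    using fic_subst[OF T abelian, of "\<lambda>y. if y = 0 then {#1#} else {#0#}"]
    by (simp add: repeat_mset_single)
  then show ?thesis using abelian fic_sym[OF T] fic_trans[OF T] by (metis add.commute)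
qed

text \<open>An extension \<open>T'\<close> of a theory with \<open>x = x\<^bsup>1+m\<^esup>\<close> is determined by the finitely many identities
  \<open>x\<^bsup>i+m\<^esup> y\<^sup>m = x\<^bsup>j+m\<^esup> y\<^sup>m\<close> with \<open>i, j < m\<close>, and by whether it contains \<open>x\<^sup>m = y\<^sup>m\<close>.\<close>

lemma compl_reg_finite_extensions:
  assumes T: "fic T" and c: "power_id T 1 (1 + m)" and m: "m \<ge> 1"
  shows "finite {T'. fic T' \<and> T \<subseteq> T'}"
proof -
  define W where "W i = replicate_mset (i + m) (0::nat) + replicate_mset m 1" for i
  define E where "E T' = {(i, j). i < m \<and> j < m \<and> (W i, W j) \<in> T'}" for T'
  define g where "g T' \<longleftrightarrow> (replicate_mset m 0, replicate_mset m 1) \<in> T'"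
    for T' :: "(nat multiset \<times> nat multiset) set"
  have key: "T1 \<subseteq> T2"
    if 1: "fic T1" "T \<subseteq> T1" and 2: "fic T2" "T \<subseteq> T2" and E: "E T1 = E T2" and g: "g T1 = g T2" for T1 T2
  proof (rule subrelI)
    fix s t assume st: "(s, t) \<in> T1"
    have c1: "power_id T1 1 (1 + m)" and c2: "power_id T2 1 (1 + m)" using c 1(2) 2(2) by (auto simp: power_id_def)
    have ne: "s \<noteq> {#}" "t \<noteq> {#}" using fic_ne[OF 1(1) st] by auto
    \<comment> \<open>If \<open>x^m = y^m\<close> holds, every \<open>m\<close>-th power acts as a
      neutral element; otherwise \<open>s\<close> and \<open>t\<close> have the same content and
      absorb powers of their own letters.\<close>
    have absorb: "(s, s + repeat_mset m u) \<in> T2 \<and> (t, t + repeat_mset m u) \<in> T2"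
      if u: "set_mset u \<subseteq> set_mset s \<union> set_mset t" for u
    proof (cases "g T2")
      case True
      have "(w, w + repeat_mset m u) \<in> T2" if w: "w \<noteq> {#}" for w
      proof (cases "u = {#}")
        case False
        have "(repeat_mset m w, repeat_mset m u) \<in> T2"
          using fic_subst[OF 2(1) True[unfolded g_def], of "\<lambda>y. if y = 0 then w else u"] w False
          by simp
        then show ?thesis
          using fic_add_left[OF 2(1)] compl_reg_absorb[OF 2(1) c2 subset_refl w] fic_trans[OF 2(1)] by blast
      qed (use w fic_refl[OF 2(1)] in simp)
      then show ?thesis using ne by simp
    next
      case False
      then have "\<not> g T1" using g by simp
      then have "set_mset s = set_mset t"
        using compl_reg_different_content[OF 1(1) c1 m st] compl_reg_different_content[OF 1(1) c1 m fic_sym[OF 1(1) st]]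
        unfolding g_def by blast
      then show ?thesis using u compl_reg_absorb[OF 2(1) c2] ne by simp
    qed
    \<comment> \<open>\<open>q^m\<close> involves every letter of both sides and serves as a common
      neutral factor; the sides are compared after multiplying by it.\<close>
    define q where "q = mset_set (set_mset s \<union> set_mset t)"
    have q: "set_mset q = set_mset s \<union> set_mset t" by (simp add: q_def)
    then have qne: "q \<noteq> {#}" using ne by auto
    have red: "(replicate_mset (i + m) x + repeat_mset (m * Suc k) w,
        replicate_mset (i mod m + m) x + repeat_mset m w) \<in> S"
      if S: "fic S" "power_id S 1 (1 + m)" and w: "w \<noteq> {#}" for S i x k w
    proof -
      have "power_id S (i mod m + m) (i mod m + m + i div m * m)" "power_id S m (m + k * m)"
        by (rule power_id_shift[OF S], use m in simp)+
      moreover have "i mod m + m + i div m * m = i + m" "m + k * m = m * Suc k" by simp_all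
      ultimately have "power_id S (i + m) (i mod m + m)" "power_id S (m * Suc k) m"
        using power_id_sym[OF S(1)] by metis+
      then show ?thesis
        using fic_plus[OF S(1) power_id_replicate[OF S(1)] power_id_instance[OF S(1) _ w]] by blast
    qed
    have "(s + repeat_mset m q, t + repeat_mset m q) \<in> T2"
    proof (rule pointwise_congruence[of "\<lambda>u v. (u + repeat_mset m q, v + repeat_mset m q) \<in> T2"])
      show "(u + repeat_mset m q, u + repeat_mset m q) \<in> T2" for u
        by (rule fic_refl[OF 2(1)]) (use m qne in \<open>simp add: repeat_mset_empty_iff\<close>)
      show "(w + u + repeat_mset m q, w + v + repeat_mset m q) \<in> T2"
        if "(u + repeat_mset m q, v + repeat_mset m q) \<in> T2" for u v w
        using fic_add_left[OF 2(1) that, of w] by (simp add: ac_simps)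
      show "(replicate_mset (count s x) x + repeat_mset m q, replicate_mset (count t x) x + repeat_mset m q) \<in> T2" for x
      proof (cases "x \<in># q")
        case False
        then have "count s x = 0" "count t x = 0" using q by (auto simp: not_in_iff)
        then show ?thesis using m qne by (auto intro!: fic_refl[OF 2(1)] simp: repeat_mset_empty_iff)
      next
        case True
        let ?i = "count s x" and ?j = "count t x"
        let ?k = "size {#y \<in># s. y \<noteq> x#}" and ?l = "size {#y \<in># t. y \<noteq> x#}"
        let ?z = "replicate_mset m (0::nat)" and ?o = "replicate_mset m (1::nat)"
        \<comment> \<open>Probe in \<open>T1\<close>: \<open>x\<close> becomes the letter
          \<open>0\<close>, every other variable becomes \<open>?o\<close>. Multiplying by
          \<open>?z + ?o\<close> and reducing exponents brings both sides to the form
          \<open>W\<close>, where \<open>E\<close> transfers the identity to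
          \<open>T2\<close>.\<close>
        have "(replicate_mset ?i 0 + repeat_mset ?k ?o, replicate_mset ?j 0 + repeat_mset ?l ?o) \<in> T1"
          using fic_subst[OF 1(1) st, of "\<lambda>y. if y = x then {#0#} else ?o"] m
          by (simp add: subst_word_two repeat_mset_single)
        from fic_add[OF 1(1) this, of "?z + ?o"]
        have "(replicate_mset (?i + m) 0 + repeat_mset (m * Suc ?k) {#1#},
               replicate_mset (?j + m) 0 + repeat_mset (m * Suc ?l) {#1#}) \<in> T1"
          by (simp add: repeat_mset_single repeat_mset_replicate replicate_mset_plus ac_simps)
        moreover have "(replicate_mset (?i + m) 0 + repeat_mset (m * Suc ?k) {#1#}, W (?i mod m)) \<in> T1"
          "(replicate_mset (?j + m) 0 + repeat_mset (m * Suc ?l) {#1#}, W (?j mod m)) \<in> T1"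
          using red[OF 1(1) c1, of "{#1#}"] unfolding W_def by (simp_all add: repeat_mset_single)
        ultimately have "(W (?i mod m), W (?j mod m)) \<in> T1"
          using fic_trans[OF 1(1)] fic_sym[OF 1(1)] by blast
        then have "(?i mod m, ?j mod m) \<in> E T1" using m by (simp add: E_def)
        then have "(W (?i mod m), W (?j mod m)) \<in> T2" unfolding E by (simp add: E_def)
        from fic_subst[OF 2(1) this, of "\<lambda>y. if y = 0 then {#x#} else q"] qne
        have "(replicate_mset (?i mod m + m) x + repeat_mset m q, replicate_mset (?j mod m + m) x + repeat_mset m q) \<in> T2"
          by (simp add: W_def repeat_mset_single)
        moreover have red2: "(replicate_mset (k + m) x + repeat_mset m q, replicate_mset (k mod m + m) x + repeat_mset m q) \<in> T2" for k
          using red[OF 2(1) c2 qne, of k x 0] by simp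
        ultimately have "(replicate_mset (?i + m) x + repeat_mset m q, replicate_mset (?j + m) x + repeat_mset m q) \<in> T2"
          using fic_trans[OF 2(1) fic_trans[OF 2(1) red2] fic_sym[OF 2(1) red2]] by blast
        \<comment> \<open>As \<open>x\<close> divides \<open>q^m\<close>, the shift of the exponent
          by \<open>m\<close> built into \<open>W\<close> can be undone.\<close>
        moreover have "x \<in># repeat_mset m q"
          using True m by (simp add: count_greater_zero_iff[symmetric] del: count_greater_zero_iff)
        then have "(replicate_mset k x + repeat_mset m q, replicate_mset (k + m) x + repeat_mset m q) \<in> T2" for k
          using compl_reg_absorb[OF 2(1) c2, of "{#x#}" "replicate_mset k x + repeat_mset m q"] True m qne
          by (simp add: repeat_mset_single repeat_mset_empty_iff replicate_mset_plus ac_simps)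
        ultimately show ?thesis
          using fic_trans[OF 2(1) fic_trans[OF 2(1)] fic_sym[OF 2(1)]] by blast
      qed
    qed (rule fic_trans[OF 2(1)])
    then show "(s, t) \<in> T2"
      using absorb[of q] q fic_trans[OF 2(1) fic_trans[OF 2(1)] fic_sym[OF 2(1)]] by blast
  qed
  have "inj_on (\<lambda>T'. (E T', g T')) {T'. fic T' \<and> T \<subseteq> T'}"
    by (rule inj_onI, rule equalityI; rule key) auto
  moreover have "(\<lambda>T'. (E T', g T')) ` {T'. fic T' \<and> T \<subseteq> T'} \<subseteq> Pow ({..<m} \<times> {..<m}) \<times> UNIV"
    by (auto simp: E_def)
  ultimately show ?thesis by (rule inj_on_finite) simp
qed

section \<open>Nil theories\<close>

text \<open>The Rees congruence of an ideal \<open>Z\<close> of words: \<open>Z\<close> collapses to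
  a zero and all other words stay apart.\<close>

definition ideal_theory :: "(nat multiset \<Rightarrow> bool) \<Rightarrow> (nat multiset \<times> nat multiset) set" where
  "ideal_theory Z = {(s, t). s \<noteq> {#} \<and> t \<noteq> {#} \<and> (s = t \<or> Z s \<and> Z t)}"

lemma fic_ideal_theory:
  assumes "\<And>s u. Z s \<Longrightarrow> Z (s + u)"
    and "\<And>\<sigma> s. (\<And>x. \<sigma> x \<noteq> {#}) \<Longrightarrow> Z s \<Longrightarrow> Z (subst_word \<sigma> s)"
  shows "fic (ideal_theory Z)"
  by (rule ficI) (use assms in \<open>auto simp: ideal_theory_def subst_word_nonempty\<close>)

section \<open>Linear words and the theories \<open>N2\<close>, \<open>Rn\<close> and
  \<open>Pn\<close>\<close>

definition lin :: "nat multiset \<Rightarrow> bool" where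
  "lin s \<longleftrightarrow> (\<forall>x. count s x \<le> 1)"

lemma not_lin_add: "\<not> lin s \<Longrightarrow> \<not> lin (s + u)"
  unfolding lin_def by (metis count_union le_add1 le_trans)

lemma not_lin_square: "u \<noteq> {#} \<Longrightarrow> \<not> lin (u + u + w)"
proof
  assume "u \<noteq> {#}" "lin (u + u + w)"
  then obtain x where "x \<in># u" by (auto elim: multiset_nonemptyE)
  then have "count u x \<ge> 1" by simp
  moreover have "count (u + u + w) x \<le> 1" using \<open>lin (u + u + w)\<close> unfolding lin_def by blast
  ultimately show False unfolding count_union by linarith
qed

lemma not_lin_subst:
  assumes "\<And>x. \<sigma> x \<noteq> {#}" "\<not> lin s" shows "\<not> lin (subst_word \<sigma> s)"
proof -
  obtain x where "count s x \<ge> 2" using assms(2)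
    by (auto simp: lin_def not_le numeral_2_eq_2 Suc_le_eq)
  then have "{#x, x#} \<subseteq># s"
    by (metis count_le_replicate_mset_subset_eq numeral_2_eq_2 replicate_mset_0 replicate_mset_Suc)
  then obtain s' where "s = {#x, x#} + s'" by (metis subset_mset.le_iff_add)
  then have "subst_word \<sigma> s = \<sigma> x + \<sigma> x + subst_word \<sigma> s'" by (simp add: ac_simps)
  then show ?thesis using not_lin_square assms(1) by metis
qed

text \<open>The letters of \<open>s\<close> are distinct, so their images can be chosen
  independently: each takes one letter of \<open>w\<close>, and the last takes whatever is
  left.\<close>

lemma lin_instance:
  assumes "lin s" "s \<noteq> {#}" "size s \<le> size w"
  shows "\<exists>\<sigma>. (\<forall>x. \<sigma> x \<noteq> {#}) \<and> subst_word \<sigma> s = w"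
  using assms
proof (induction s arbitrary: w)
  case (add x s)
  have wne: "w \<noteq> {#}" using add.prems(3) by auto
  show ?case
  proof (cases "s = {#}")
    case True then show ?thesis using wne by (intro exI[of _ "\<lambda>_. w"]) simp
  next
    case False
    obtain a w' where w: "w = add_mset a w'" using wne by (meson multiset_cases)
    have "lin s" unfolding lin_def
    proof
      fix y show "count s y \<le> 1" using add.prems(1) unfolding lin_def
        by (metis count_add_mset le_SucI Suc_leD order_refl le_trans)
    qed
    moreover have "x \<notin># s" using add.prems(1) unfolding lin_def
      by (metis count_add_mset count_greater_zero_iff not_less_eq_eq not_le One_nat_def Suc_le_eq)
    moreover have "size s \<le> size w'" using add.prems(3) w by simp
    ultimately obtain \<sigma> where \<sigma>: "\<forall>x. \<sigma> x \<noteq> {#}" "subst_word \<sigma> s = w'"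
      using add.IH False by blast
    define \<tau> where "\<tau> = \<sigma>(x := {#a#})"
    have "subst_word \<tau> s = subst_word \<sigma> s"
      by (rule subst_word_cong) (use \<open>x \<notin># s\<close> in \<open>auto simp: \<tau>_def\<close>)
    then have "(\<forall>y. \<tau> y \<noteq> {#}) \<and> subst_word \<tau> (add_mset x s) = w"
      using \<sigma> w by (simp add: \<tau>_def)
    then show ?thesis by blast
  qed
qed simp

definition N2 :: "(nat multiset \<times> nat multiset) set" where
  "N2 = ideal_theory (\<lambda>s. \<not> lin s)"

definition Rn :: "nat \<Rightarrow> (nat multiset \<times> nat multiset) set" where
  "Rn k = ideal_theory (\<lambda>s. \<not> lin s \<or> k \<le> size s)"

definition Pn :: "nat \<Rightarrow> (nat multiset \<times> nat multiset) set" where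
  "Pn k = ideal_theory (\<lambda>s. k \<le> size s)"

lemma fic_N2: "fic N2"
  unfolding N2_def by (rule fic_ideal_theory) (auto simp: not_lin_add not_lin_subst)

lemma fic_Rn: "fic (Rn k)"
  unfolding Rn_def
  by (rule fic_ideal_theory)
    (auto simp: not_lin_add not_lin_subst intro: le_trans[OF _ size_subst_word])

lemma fic_Pn: "fic (Pn k)"
  unfolding Pn_def by (rule fic_ideal_theory) (auto intro: le_trans[OF _ size_subst_word])

lemma Rn_antimono: "j \<le> k \<Longrightarrow> Rn k \<subseteq> Rn j"
  by (auto simp: Rn_def ideal_theory_def)

lemma N2_subset_Rn: "N2 \<subseteq> Rn k"
  by (auto simp: Rn_def N2_def ideal_theory_def)

lemma Pn_subset_Rn: "Pn k \<subseteq> Rn k"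
  by (auto simp: Rn_def Pn_def ideal_theory_def)

definition lword :: "nat \<Rightarrow> nat multiset" where
  "lword k = mset_set {..<k}"

lemma lword [simp]: "size (lword k) = k" "lin (lword k)" "lword k = {#} \<longleftrightarrow> k = 0"
  by (auto simp: lword_def lin_def count_mset_set' mset_set_empty_iff)

lemma lword_square: "k \<ge> 1 \<Longrightarrow> \<not> lin (lword k + lword k)"
  using not_lin_square[of "lword k" "{#}"] by simp

text \<open>A test identity separating the theories: the square lies in the zero class, so it asks
  whether a product of \<open>k\<close> distinct variables is zero.\<close>

lemma lword_in_Rn:
  assumes "k \<ge> 1"
  shows "(lword k, lword k + lword k) \<in> Rn j \<longleftrightarrow> j \<le> k" "(lword k, lword k + lword k) \<notin> N2"
    "(lword k, lword k + lword k) \<in> Pn k"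
  using assms lword_square[OF assms] by (auto simp: Rn_def N2_def Pn_def ideal_theory_def)

lemma Rn_subset_iff: "k \<ge> 1 \<Longrightarrow> Rn k \<subseteq> Rn j \<longleftrightarrow> j \<le> k"
  using Rn_antimono lword_in_Rn(1)[of k] by blast

lemma Rn_not_subset_N2: "k \<ge> 1 \<Longrightarrow> \<not> Rn k \<subseteq> N2"
  using lword_in_Rn[of k] by blast

lemma Rn_1: "Rn 1 = cwords \<times> cwords"
  by (auto simp: Rn_def ideal_theory_def cwords_def Suc_le_eq nonempty_has_size)

text \<open>\<open>Rn 2\<close> is the theory of null semigroups, \<open>xy = 0\<close>. A
  nontrivial identity outside it has a single letter on one side: \<open>x = y\<close> gives
  \<open>x = x^2\<close>, and \<open>x = t\<close> with a longer \<open>t\<close> gives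
  \<open>x = x^|t|\<close>.\<close>

lemma compl_reg_iff:
  assumes T: "fic T" shows "compl_reg T \<longleftrightarrow> \<not> T \<subseteq> Rn 2"
proof
  assume "compl_reg T"
  then obtain c where c: "c \<ge> 1" "power_id T 1 (1 + c)" by (auto simp: compl_reg_def)
  have "({#0#}, replicate_mset (1 + c) 0) \<notin> Rn 2"
    using c(1) by (auto simp: Rn_def ideal_theory_def lin_def)
  then show "\<not> T \<subseteq> Rn 2" using c(2) by (auto simp: power_id_def)
next
  assume "\<not> T \<subseteq> Rn 2"
  then obtain s t where st: "(s, t) \<in> T" "(s, t) \<notin> Rn 2" by auto
  have "\<exists>s t. (s, t) \<in> T \<and> s \<noteq> t \<and> size s < 2"
    using st fic_ne[OF T st(1)] fic_sym[OF T st(1)]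
    by (auto simp: Rn_def ideal_theory_def not_le)
  then obtain s t where st: "(s, t) \<in> T" "s \<noteq> t" "size s < 2" by blast
  have "size s \<noteq> 0" using fic_ne[OF T st(1)] by simp
  then have "size s = 1" using st(3) by linarith
  then obtain x where s: "s = {#x#}" using size_1_singleton_mset by blast
  show "compl_reg T"
  proof (cases "size t = 1")
    case True
    then obtain y where t: "t = {#y#}" using size_1_singleton_mset by blast
    then have "x \<noteq> y" using s st(2) by simp
    then have "power_id T 1 2"
      using power_id_two[OF T st(1), of 1 2 x] s t by (simp add: numeral_2_eq_2)
    then show ?thesis unfolding compl_reg_def by (intro exI[of _ 1]) (simp add: numeral_2_eq_2)
  next
    case False
    have "size t \<noteq> 0" using fic_ne[OF T st(1)] by simp
    with False have "size t \<ge> 2" by linarith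
    then show ?thesis using power_id_size[OF T st(1)] s unfolding compl_reg_def
      by (intro exI[of _ "size t - 1"]) simp
  qed
qed

definition nil_theory :: "(nat multiset \<times> nat multiset) set \<Rightarrow> bool" where
  "nil_theory T \<longleftrightarrow> (\<forall>U. fic U \<longrightarrow> T \<subseteq> U \<longrightarrow> compl_reg U \<longrightarrow> U = cwords \<times> cwords)"

text \<open>\<open>replicate_mset c 0\<close> serves as a name for the zero: it equals all
  \<open>c\<close>-th powers and all their multiples.\<close>

definition nil :: "(nat multiset \<times> nat multiset) set \<Rightarrow> nat \<Rightarrow> bool" where
  "nil T c \<longleftrightarrow> c \<ge> 1 \<and> (\<forall>w u. w \<noteq> {#} \<longrightarrow> (repeat_mset c w + u, replicate_mset c 0) \<in> T)"

lemma abelian_2_not_full: "abelian 2 \<noteq> cwords \<times> cwords"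
proof
  assume "abelian 2 = cwords \<times> cwords"
  then have "({#0#}, {#1#}) \<in> abelian 2" by (simp add: cwords_def)
  then have "count {#0::nat#} 0 mod 2 = count {#1::nat#} 0 mod 2"
    using abelian_iff[of 2] by (metis one_le_numeral)
  then show False by simp
qed

text \<open>Not lying in \<open>abelian 2\<close>, \<open>T\<close> has a nontrivial identity, so
  powers are periodic and a suitable root of \<open>T\<close> is completely regular. By hypothesis
  that root is trivial: all powers with this exponent coincide in \<open>T\<close>, and their common
  value turns out to be absorbing.\<close>

lemma nil_theory_imp_nil:
  assumes T: "fic T" and N: "nil_theory T" shows "\<exists>c. nil T c"
proof -
  have "\<not> T \<subseteq> abelian 2" using N compl_reg_abelian[of 2] fic_abelian abelian_2_not_full by (auto simp: nil_theory_def)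
  then obtain s t where st: "(s, t) \<in> T" "(s, t) \<notin> abelian 2" by auto
  then have "s \<noteq> t" using fic_refl[OF fic_abelian, of s 2] fic_ne[OF T st(1)] by auto
  then obtain n r where nr: "n \<ge> 1" "r \<ge> 1" "power_id T n (n + r)" using periodic[OF T st(1)] by blast
  \<comment> \<open>A multiple of the period \<open>r\<close> that is at least \<open>n\<close>, so
    that \<open>x^e\<close> is idempotent.\<close>
  define e where "e = n * r"
  have e: "e \<ge> 1" "n \<le> e" using nr by (auto simp: e_def)
  have pe: "power_id T e (e + e)" using power_id_shift[OF T nr(3) e(2), of n] by (simp add: e_def)
  have "power_id (root (e + 1) T) 1 (1 + e)"
    using power_id_shift[OF T pe, of "e + 1" "e + 1"] by (simp add: power_id_root algebra_simps)
  then have "compl_reg (root (e + 1) T)" using e(1) by (auto simp: compl_reg_def)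
  then have "root (e + 1) T = cwords \<times> cwords"
    using N fic_root[OF T, of "e + 1"] by (simp add: nil_theory_def)
  then have all: "(repeat_mset (e + 1) u, repeat_mset (e + 1) v) \<in> T" if "u \<noteq> {#}" "v \<noteq> {#}" for u v
    using that by (auto simp: root_def cwords_def)
  have "(repeat_mset (e + 1) w + u, replicate_mset (e + 1) 0) \<in> T" if w: "w \<noteq> {#}" for w u
  proof (cases "u = {#}")
    case True then show ?thesis using all[OF w, of "{#0#}"] by (simp add: repeat_mset_single)
  next
    case False
    \<comment> \<open>With \<open>f = e + 1\<close>:
      \<open>w^f u = u^f u = u^(e+2) = u^(2f) = (uu)^f\<close>, again an \<open>f\<close>-th
      power.\<close>
    have "(repeat_mset (e + 1) w + u, repeat_mset (e + 1) u + u) \<in> T"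
      by (rule fic_add[OF T all[OF w False]])
    moreover have "repeat_mset (e + 1) u + u = repeat_mset (e + 2) u"
      by (rule multiset_eqI) simp
    moreover have "(repeat_mset (e + 2) u, repeat_mset (e + 2 + e) u) \<in> T"
      using power_id_instance[OF T _ False, of "e + 2" "e + 2 + e"] power_id_shift[OF T pe, of "e + 2" 1] by simp
    moreover have "repeat_mset (e + 2 + e) u = repeat_mset (e + 1) (u + u)"
      by (rule multiset_eqI) (simp add: algebra_simps)
    moreover have "(repeat_mset (e + 1) (u + u), replicate_mset (e + 1) 0) \<in> T"
      using all[of "u + u" "{#0#}"] False by (simp add: repeat_mset_single)
    ultimately show ?thesis using fic_trans[OF T] by metis
  qed
  then have "nil T (e + 1)" by (simp add: nil_def)
  then show ?thesis by blast
qed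

section \<open>Calculations with a zero\<close>

context
  fixes T c assumes T: "fic T" and nil: "nil T c"
begin

abbreviation null_word where "null_word \<equiv> replicate_mset c (0::nat)"

lemma zero_repeat: "w \<noteq> {#} \<Longrightarrow> (repeat_mset c w + u, null_word) \<in> T"
  using nil by (simp add: nil_def)

lemma zero_multiple: "(w, null_word) \<in> T \<Longrightarrow> (w + u, null_word) \<in> T"
proof -
  have "(repeat_mset c {#0#} + u, null_word) \<in> T" by (rule zero_repeat) simp
  then show "(w, null_word) \<in> T \<Longrightarrow> (w + u, null_word) \<in> T"
    using fic_trans[OF T fic_add[OF T]] by (simp add: repeat_mset_single)
qed

lemma zero_instance:
  assumes "(w, null_word) \<in> T" "\<And>x. \<sigma> x \<noteq> {#}" shows "(subst_word \<sigma> w, null_word) \<in> T"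
proof -
  have "(subst_word \<sigma> w, repeat_mset c (\<sigma> 0)) \<in> T"
    using fic_subst[OF T assms(1), of \<sigma>] assms(2) by simp
  moreover have "(repeat_mset c (\<sigma> 0) + {#}, null_word) \<in> T"
    by (rule zero_repeat) (rule assms(2))
  ultimately show ?thesis using fic_trans[OF T] by simp
qed

lemma zero_class: "(u, null_word) \<in> T \<Longrightarrow> (v, null_word) \<in> T \<Longrightarrow> (u, v) \<in> T"
  using fic_sym[OF T] fic_trans[OF T] by blast

text \<open>Replace a letter \<open>x\<close> occurring on one side only by \<open>x^c\<close>: that
  side becomes zero and the other does not change.\<close>

lemma zero_if_content_differs:
  assumes st: "(s, t) \<in> T" and ne: "set_mset s \<noteq> set_mset t" shows "(s, null_word) \<in> T"
proof -
  have *: "(t', null_word) \<in> T" if st': "(s', t') \<in> T" and x: "x \<in># s'" "x \<notin># t'" for s' t' x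
  proof -
    let ?\<sigma> = "\<lambda>y. if y = x then repeat_mset c {#x#} else {#y#}"
    have c: "c \<ge> 1" using nil by (simp add: nil_def)
    have "subst_word ?\<sigma> t' = subst_word (\<lambda>y. {#y#}) t'"
      by (rule subst_word_cong) (use x(2) in auto)
    then have "subst_word ?\<sigma> t' = t'" by (simp add: subst_word_id)
    moreover obtain s'' where "s' = add_mset x s''" using multi_member_split[OF x(1)] by blast
    then have "(subst_word ?\<sigma> s', null_word) \<in> T" using zero_repeat[of "{#x#}"] by simp
    moreover have "(subst_word ?\<sigma> s', subst_word ?\<sigma> t') \<in> T"
      by (rule fic_subst[OF T st']) (use c in \<open>simp add: repeat_mset_empty_iff\<close>)
    ultimately show ?thesis using fic_sym[OF T] fic_trans[OF T] by metis
  qed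
  then have "(t, null_word) \<in> T \<or> (s, null_word) \<in> T"
    using st fic_sym[OF T st] ne by blast
  then show ?thesis using fic_trans[OF T st] by blast
qed

text \<open>Iteration gives \<open>s = s u^k\<close> for all \<open>k\<close>, and
  \<open>u^c\<close> is zero.\<close>

lemma zero_if_proper_multiple:
  assumes "(s, s + u) \<in> T" "u \<noteq> {#}" shows "(s, null_word) \<in> T"
proof -
  have "(s, s + repeat_mset k u) \<in> T" for k
  proof (induction k)
    case 0 then show ?case using fic_refl[OF T] fic_ne[OF T assms(1)] by simp
  next
    case (Suc k)
    have "(s + repeat_mset k u, s + u + repeat_mset k u) \<in> T" by (rule fic_add[OF T assms(1)])
    then show ?case using fic_trans[OF T Suc] by (simp add: repeat_mset_Suc add.assoc)
  qed
  moreover have "(repeat_mset c u + s, null_word) \<in> T" by (rule zero_repeat[OF assms(2)])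
  ultimately show ?thesis using fic_trans[OF T] by (metis add.commute)
qed

text \<open>If the contents agree, a linear \<open>s\<close> divides \<open>t\<close>, so
  \<open>t\<close> is a proper multiple of it. In either case \<open>s\<close> is zero, and every
  word that is at least as long is an instance of \<open>s\<close>.\<close>

lemma zero_if_linear:
  assumes st: "(s, t) \<in> T" "s \<noteq> t" and s: "lin s" and w: "size s \<le> size w"
  shows "(w, null_word) \<in> T"
proof -
  have sne: "s \<noteq> {#}" using fic_ne[OF T st(1)] by simp
  have "(s, null_word) \<in> T"
  proof (cases "set_mset s = set_mset t")
    case True
    have "s \<subseteq># t"
    proof (rule mset_subset_eqI)
      fix x show "count s x \<le> count t x"
      proof (cases "x \<in># s")
        case True
        then have "x \<in># t" using \<open>set_mset s = set_mset t\<close> by simp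
        then have "1 \<le> count t x" by simp
        then show ?thesis using s unfolding lin_def by (metis le_trans)
      qed (simp add: not_in_iff)
    qed
    then obtain u where "t = s + u" by (metis subset_mset.le_iff_add)
    then show ?thesis using zero_if_proper_multiple st by auto
  qed (rule zero_if_content_differs[OF st(1)])
  moreover obtain \<sigma> where "\<forall>x. \<sigma> x \<noteq> {#}" "subst_word \<sigma> s = w"
    using lin_instance[OF s sne w] by blast
  ultimately show ?thesis using zero_instance by metis
qed

end

text \<open>A completely regular extension satisfies \<open>x = x^n\<close> for some
  \<open>n \<ge> k\<close>, while all words of length at least \<open>k\<close> are equal; hence
  \<open>x = y\<close>.\<close>

lemma nil_theory_Pn: "nil_theory (Pn k)"
  unfolding nil_theory_def
proof (intro allI impI)
  fix U assume U: "fic U" "Pn k \<subseteq> U" "compl_reg U"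
  obtain c where c: "c \<ge> 1" "power_id U 1 (1 + c)" using U(3) by (auto simp: compl_reg_def)
  define n where "n = 1 + k * c"
  have n: "power_id U 1 n" "n \<ge> k"
    using power_id_shift[OF U(1) c(2), of 1 k] c(1) by (simp_all add: n_def le_SucI)
  have "(u, repeat_mset n u) \<in> U" if "u \<noteq> {#}" for u
    using power_id_instance[OF U(1) n(1) that] by simp
  moreover have "(replicate_mset n 0, replicate_mset n 1) \<in> U"
    using U(2) n(2) by (auto simp: Pn_def ideal_theory_def n_def)
  ultimately have "({#0#}, {#1#}) \<in> U"
    using fic_trans[OF U(1)] fic_sym[OF U(1)] by (metis empty_not_add_mset repeat_mset_single)
  then show "U = cwords \<times> cwords" by (rule fic_full_if_vars[OF U(1)])
qed

text \<open>A nontrivial identity outside \<open>Rn (k + 1)\<close> has a linear side of length at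
  most \<open>k\<close>, which makes all words of length \<open>k\<close> or more zero. The converse
  is tested on \<open>lword k\<close>.\<close>

lemma nil_theory_not_subset_Rn_iff:
  assumes T: "fic T" and N: "nil_theory T" and k: "k \<ge> 1"
  shows "\<not> T \<subseteq> Rn (k + 1) \<longleftrightarrow> Pn k \<subseteq> T"
proof
  assume "\<not> T \<subseteq> Rn (k + 1)"
  then obtain s t where st: "(s, t) \<in> T" "(s, t) \<notin> Rn (k + 1)" by auto
  obtain c where c: "nil T c" using nil_theory_imp_nil[OF T N] by blast
  have "\<exists>s t. (s, t) \<in> T \<and> s \<noteq> t \<and> lin s \<and> size s \<le> k"
    using st fic_ne[OF T st(1)] fic_sym[OF T st(1)]
    by (auto simp: Rn_def ideal_theory_def not_less_eq_eq)
  then obtain s t where st: "(s, t) \<in> T" "s \<noteq> t" "lin s" "size s \<le> k" by blast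
  have z: "(w, replicate_mset c 0) \<in> T" if "k \<le> size w" for w
    using zero_if_linear[OF T c st(1-3)] st(4) that by simp
  show "Pn k \<subseteq> T"
    using zero_class[OF T c] z fic_refl[OF T] by (auto simp: Pn_def ideal_theory_def)
next
  assume "Pn k \<subseteq> T"
  then have "(lword k, lword k + lword k) \<in> T" using lword_in_Rn(3)[OF k] by blast
  then show "\<not> T \<subseteq> Rn (k + 1)" using lword_in_Rn(1)[OF k, of "k + 1"] by auto
qed

lemma Pn_unique:
  assumes T: "fic T" and k: "k \<ge> 1"
  shows "T = Pn k \<longleftrightarrow> nil_theory T \<and> \<not> T \<subseteq> Rn (k + 1) \<and> (\<forall>U. fic U \<longrightarrow> nil_theory U \<longrightarrow> \<not> U \<subseteq> Rn (k + 1) \<longrightarrow> T \<subseteq> U)"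
proof
  assume "T = Pn k"
  then show "nil_theory T \<and> \<not> T \<subseteq> Rn (k + 1) \<and> (\<forall>U. fic U \<longrightarrow> nil_theory U \<longrightarrow> \<not> U \<subseteq> Rn (k + 1) \<longrightarrow> T \<subseteq> U)"
    using nil_theory_Pn nil_theory_not_subset_Rn_iff[OF _ _ k] T by simp
next
  assume R: "nil_theory T \<and> \<not> T \<subseteq> Rn (k + 1) \<and> (\<forall>U. fic U \<longrightarrow> nil_theory U \<longrightarrow> \<not> U \<subseteq> Rn (k + 1) \<longrightarrow> T \<subseteq> U)"
  then have "Pn k \<subseteq> T" using nil_theory_not_subset_Rn_iff[OF T _ k] by simp
  moreover have "T \<subseteq> Pn k"
    using R fic_Pn nil_theory_Pn nil_theory_not_subset_Rn_iff[OF fic_Pn nil_theory_Pn k] by simp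
  ultimately show "T = Pn k" by simp
qed

section \<open>The extensions of \<open>N2\<close> and its description by the order\<close>

lemma nil_N2: "N2 \<subseteq> T \<Longrightarrow> nil T 2"
proof -
  have "\<not> lin (repeat_mset 2 w + u)" if "w \<noteq> {#}" for w u
    using not_lin_square[OF that, of u] by (simp add: numeral_2_eq_2 repeat_mset_Suc)
  moreover have "\<not> lin (replicate_mset 2 0)" by (auto simp: lin_def)
  ultimately have "(repeat_mset 2 w + u, replicate_mset 2 0) \<in> N2" if "w \<noteq> {#}" for w u
    using that by (simp add: N2_def ideal_theory_def repeat_mset_empty_iff)
  then show "N2 \<subseteq> T \<Longrightarrow> nil T 2" by (auto simp: nil_def)
qed

text \<open>Let \<open>k\<close> be the least length of a linear side of a nontrivial identity of
  \<open>T\<close>. Words of length at least \<open>k\<close> are then zero, while shorter linear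
  words equal only themselves.\<close>

lemma above_N2:
  assumes T: "fic T" and N: "N2 \<subseteq> T" and "T \<noteq> N2"
  shows "\<exists>k\<ge>1. T = Rn k"
proof -
  define Q where "Q k \<longleftrightarrow> (\<exists>s t. (s, t) \<in> T \<and> s \<noteq> t \<and> lin s \<and> size s = k)" for k
  obtain s t where st: "(s, t) \<in> T" "(s, t) \<notin> N2" using assms(2,3) by auto
  then have "\<exists>k. Q k"
    using fic_ne[OF T st(1)] fic_sym[OF T st(1)] by (auto simp: N2_def ideal_theory_def Q_def)
  then have Q: "Q (LEAST k. Q k)" by (metis LeastI_ex)
  define k where "k = (LEAST k. Q k)"
  obtain s t where st: "(s, t) \<in> T" "s \<noteq> t" "lin s" "size s = k"
    using Q by (auto simp: Q_def k_def)
  have least: "k \<le> size u" if "(u, v) \<in> T" "u \<noteq> v" "lin u" for u v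
    unfolding k_def by (rule Least_le) (use that in \<open>auto simp: Q_def\<close>)
  have n: "nil T 2" by (rule nil_N2[OF N])
  have z: "(w, replicate_mset 2 0) \<in> T" if "w \<noteq> {#}" "\<not> lin w \<or> k \<le> size w" for w
  proof (cases "lin w")
    case True then show ?thesis using zero_if_linear[OF T n st(1-3)] st(4) that by simp
  next
    case False
    then have "(w, replicate_mset 2 0) \<in> N2"
      using that(1) by (auto simp: N2_def ideal_theory_def lin_def)
    then show ?thesis using N by blast
  qed
  have "(u, v) \<in> T" if uv: "(u, v) \<in> Rn k" for u v
  proof (cases "u = v")
    case True then show ?thesis using uv fic_refl[OF T] by (simp add: Rn_def ideal_theory_def)
  next
    case False then show ?thesis
      using uv zero_class[OF T n z z] by (simp add: Rn_def ideal_theory_def)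
  qed
  moreover have "(u, v) \<in> Rn k" if uv: "(u, v) \<in> T" for u v
    using least[OF uv] least[OF fic_sym[OF T uv]] fic_ne[OF T uv]
    by (auto simp: Rn_def ideal_theory_def)
  ultimately have "T = Rn k" by auto
  moreover have "k \<ge> 1" using st(4) fic_ne[OF T st(1)] by (auto simp: Suc_le_eq nonempty_has_size)
  ultimately show ?thesis by blast
qed

text \<open>The proper extensions of \<open>N2\<close> are the chain of the \<open>Rn\<close>, so
  each member is determined by the one above it. This is the recursion by which formulas reach
  \<open>Rn\<close>, starting from the full theory \<open>Rn 1\<close>.\<close>

lemma Rn_Suc_unique:
  assumes T: "fic T" and n: "n \<ge> 1"
  shows "T = Rn (Suc n) \<longleftrightarrow>
    N2 \<subseteq> T \<and> T \<subset> Rn n \<and> (\<forall>U. fic U \<longrightarrow> N2 \<subseteq> U \<longrightarrow> U \<subset> Rn n \<longrightarrow> U \<subseteq> T)"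
proof -
  have below: "U \<subseteq> Rn (Suc n)" if U: "fic U" "N2 \<subseteq> U" "U \<subset> Rn n" for U
  proof (cases "U = N2")
    case False
    then obtain k where k: "k \<ge> 1" "U = Rn k" using above_N2 U by blast
    then have "\<not> k \<le> n" using U(3) Rn_antimono[of k n] by blast
    then show ?thesis using k Rn_antimono by simp
  qed (simp add: N2_subset_Rn)
  have R: "Rn (Suc n) \<subset> Rn n" using Rn_antimono[of n "Suc n"] Rn_subset_iff[OF n, of "Suc n"] by auto
  show ?thesis
  proof (rule iffI)
    assume "T = Rn (Suc n)"
    then show "N2 \<subseteq> T \<and> T \<subset> Rn n \<and> (\<forall>U. fic U \<longrightarrow> N2 \<subseteq> U \<longrightarrow> U \<subset> Rn n \<longrightarrow> U \<subseteq> T)"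
      using below R N2_subset_Rn by simp
  next
    assume *: "N2 \<subseteq> T \<and> T \<subset> Rn n \<and> (\<forall>U. fic U \<longrightarrow> N2 \<subseteq> U \<longrightarrow> U \<subset> Rn n \<longrightarrow> U \<subseteq> T)"
    then have "T \<subseteq> Rn (Suc n)" using below T by simp
    moreover have "Rn (Suc n) \<subseteq> T" using * R N2_subset_Rn fic_Rn by simp
    ultimately show "T = Rn (Suc n)" by simp
  qed
qed

lemma not_subset_Pn:
  assumes T: "fic T" and "\<not> T \<subseteq> Pn (n + 1)"
  shows "\<exists>s t. (s, t) \<in> T \<and> s \<noteq> t \<and> size s \<le> n"
proof -
  obtain s t where st: "(s, t) \<in> T" "(s, t) \<notin> Pn (n + 1)" using assms(2) by auto
  then show ?thesis
    using fic_ne[OF T st(1)] fic_sym[OF T st(1)]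
    by (auto simp: Pn_def ideal_theory_def not_less_eq_eq)
qed

text \<open>A nontrivial identity outside \<open>Pn 3\<close> has a side of length at most 2. If
  that side is not linear it is a square \<open>y^2\<close>, and the other side has a different
  content, is \<open>y\<close>, or is a higher power of \<open>y\<close>. Each case makes squares
  zero.\<close>

lemma N2_subset_if_not_subset_P3:
  assumes T: "fic T" and n: "nil T c" and "\<not> T \<subseteq> Pn 3"
  shows "N2 \<subseteq> T"
proof -
  let ?z = "replicate_mset c (0::nat)"
  obtain s t where st: "(s, t) \<in> T" "s \<noteq> t" "size s \<le> 2"
    using not_subset_Pn[OF T, of 2] assms(3) by auto
  have sq: "({#x, x#}, ?z) \<in> T" for x
  proof (cases "lin s")
    case True then show ?thesis using zero_if_linear[OF T n st(1,2) True] st(3) by simp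
  next
    case False
    then obtain y where y: "count s y \<ge> 2" by (auto simp: lin_def not_le numeral_2_eq_2 Suc_le_eq)
    have "s = replicate_mset 2 y"
    proof (rule multiset_eqI)
      fix v show "count s v = count (replicate_mset 2 y) v"
        using y st(3) size_split[of s y] size_split[of "{#w \<in># s. w \<noteq> y#}" v]
        by (cases "v = y") auto
    qed
    then have s: "s = {#y, y#}" by (simp add: numeral_2_eq_2)
    have "({#y, y#}, ?z) \<in> T \<or> ({#x, x#}, ?z) \<in> T"
    proof (cases "set_mset t = {y}")
      case False then show ?thesis using zero_if_content_differs[OF T n st(1)] s by auto
    next
      case True
      have t: "t = replicate_mset (count t y) y"
      proof (rule multiset_eqI)
        fix v show "count t v = count (replicate_mset (count t y) y) v"
          using True by (cases "v = y") (auto simp: not_in_iff[symmetric])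
      qed
      have "count t y \<noteq> 0" "count t y \<noteq> 2"
        using t True st(2) s by (auto simp: numeral_2_eq_2)
      then consider "count t y = 1" | k where "count t y = 2 + Suc k"
        by (metis One_nat_def add_2_eq_Suc less_2_cases less_imp_Suc_add not_less_iff_gr_or_eq)
      then show ?thesis
      proof cases
        case 1
        then have "lin t" "size t \<le> 2" using t by (auto simp: lin_def)
        then show ?thesis
          using zero_if_linear[OF T n fic_sym[OF T st(1)] st(2)[symmetric], of "{#x, x#}"] by simp
      next
        case 2
        then have "t = s + replicate_mset (Suc k) y" using t s by simp
        then show ?thesis using zero_if_proper_multiple[OF T n, of s "replicate_mset (Suc k) y"] st(1) s
          by simp
      qed
    qed
    then show ?thesis
      using zero_instance[OF T n, of "{#y, y#}" "\<lambda>_. {#x#}"] by auto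
  qed
  have z: "(w, ?z) \<in> T" if w: "\<not> lin w" for w
  proof -
    obtain x where "count w x \<ge> 2" using w by (auto simp: lin_def not_le numeral_2_eq_2 Suc_le_eq)
    then have "{#x, x#} \<subseteq># w"
      by (metis count_le_replicate_mset_subset_eq numeral_2_eq_2 replicate_mset_0 replicate_mset_Suc)
    then obtain w' where "w = {#x, x#} + w'" by (metis subset_mset.le_iff_add)
    then show ?thesis using zero_multiple[OF T n sq] by simp
  qed
  have "(u, v) \<in> T" if uv: "(u, v) \<in> N2" for u v
  proof (cases "u = v")
    case True then show ?thesis using uv fic_refl[OF T] by (simp add: N2_def ideal_theory_def)
  next
    case False then show ?thesis
      using uv zero_class[OF T n z z] by (simp add: N2_def ideal_theory_def)
  qed
  then show ?thesis by auto
qed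

text \<open>Among the theories whose extensions form a chain and have no minimal proper member, the full
  theory aside, only that of \<open>x\<^sup>2 = 0\<close> survives: completely regular theories have finitely many
  extensions, and the theories of \<open>x\<^sup>2 = x\<^sub>1\<dots>x\<^sub>n = 0\<close> and of \<open>xyz = 0\<close> have a minimal proper one.\<close>

lemma N2_unique:
  assumes T: "fic T"
  shows "T = N2 \<longleftrightarrow> T \<noteq> cwords \<times> cwords \<and>
    (\<forall>A. fic A \<longrightarrow> T \<subseteq> A \<longrightarrow> (\<forall>B. fic B \<longrightarrow> T \<subseteq> B \<longrightarrow> A \<subseteq> B \<or> B \<subseteq> A)) \<and>
    (\<forall>A. fic A \<longrightarrow> T \<subset> A \<longrightarrow> (\<exists>B. fic B \<and> T \<subset> B \<and> B \<subset> A))"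
    (is "_ \<longleftrightarrow> _ \<and> ?chain \<and> ?dense")
proof
  assume TN: "T = N2"
  have "T \<noteq> cwords \<times> cwords" using Rn_not_subset_N2[of 1] Rn_1 TN by auto
  moreover have ?chain
  proof (intro allI impI)
    fix A B assume "fic A" "T \<subseteq> A" "fic B" "T \<subseteq> B"
    then have "A = N2 \<or> (\<exists>k. A = Rn k)" "B = N2 \<or> (\<exists>k. B = Rn k)" "N2 \<subseteq> A" "N2 \<subseteq> B"
      using above_N2 TN by blast+
    then show "A \<subseteq> B \<or> B \<subseteq> A" using Rn_antimono by (metis nle_le)
  qed
  moreover have ?dense
  proof (intro allI impI)
    fix A assume A: "fic A" "T \<subset> A"
    then obtain k where k: "k \<ge> 1" "A = Rn k" using above_N2[of A] TN by blast
    have "T \<subset> Rn (Suc k)" using N2_subset_Rn Rn_not_subset_N2[of "Suc k"] TN by auto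
    moreover have "Rn (Suc k) \<subset> A"
      using Rn_antimono[of k "Suc k"] Rn_subset_iff[OF k(1), of "Suc k"] k(2) by auto
    ultimately show "\<exists>B. fic B \<and> T \<subset> B \<and> B \<subset> A" using fic_Rn by blast
  qed
  ultimately show "T \<noteq> cwords \<times> cwords \<and> ?chain \<and> ?dense" by blast
next
  assume "T \<noteq> cwords \<times> cwords \<and> ?chain \<and> ?dense"
  then have ne: "T \<noteq> cwords \<times> cwords" and chain: ?chain and dense: ?dense by blast+
  have notCR: "\<not> compl_reg T"
  proof
    assume "compl_reg T"
    then obtain m where m: "m \<ge> 1" "power_id T 1 (1 + m)" by (auto simp: compl_reg_def)
    \<comment> \<open>There are finitely many proper extensions, so a minimal one exists, against
      \<open>?dense\<close>.\<close>
    let ?S = "{A. fic A \<and> T \<subset> A}"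
    have "finite ?S" by (rule finite_subset[OF _ compl_reg_finite_extensions[OF T m(2,1)]]) auto
    moreover have "cwords \<times> cwords \<in> ?S" using fic_full fic_subset_full[OF T] ne by blast
    ultimately obtain A where A: "A \<in> ?S" "\<forall>B\<in>?S. B \<subseteq> A \<longrightarrow> A = B"
      using finite_has_minimal[of ?S] by blast
    have "fic A" "T \<subset> A" using A(1) by simp_all
    then have "\<exists>B. fic B \<and> T \<subset> B \<and> B \<subset> A" using dense by simp
    then obtain B where B: "fic B" "T \<subset> B" "B \<subset> A" by (elim exE conjE)
    then have "A = B" using A(2) by simp
    then show False using B(3) by simp
  qed
  then have T2: "T \<subseteq> Rn 2" using compl_reg_iff[OF T] by blast
  have nil_theory: "nil_theory T" unfolding nil_theory_def
  proof (intro allI impI)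
    fix U assume U: "fic U" "T \<subseteq> U" "compl_reg U"
    \<comment> \<open>A completely regular \<open>U\<close> does not lie in \<open>Rn 2\<close>, so
      comparability puts \<open>Rn 2\<close>, and with it the nil theory \<open>Pn 2\<close>, inside
      \<open>U\<close>.\<close>
    then have "U \<subseteq> Rn 2 \<or> Rn 2 \<subseteq> U" using chain T2 fic_Rn[of 2] by simp
    then have "Rn 2 \<subseteq> U" using compl_reg_iff[OF U(1)] U(3) by simp
    then have "Pn 2 \<subseteq> U" using Pn_subset_Rn by blast
    then show "U = cwords \<times> cwords" using nil_theory_Pn[of 2] U unfolding nil_theory_def by blast
  qed
  obtain c where c: "nil T c" using nil_theory_imp_nil[OF T nil_theory] by blast
  have sq3: "({#0, 0#}, {#0, 0, 0#}) \<in> Rn k" "({#0, 0#}, {#0, 0, 0#}) \<notin> Pn 3" for k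
    by (auto simp: Rn_def Pn_def ideal_theory_def lin_def)
  have P3R4: "\<not> Pn 3 \<subseteq> Rn 4" using nil_theory_not_subset_Rn_iff[OF fic_Pn nil_theory_Pn, of 3 3] by simp
  show "T = N2"
  proof (rule ccontr)
    assume TN: "T \<noteq> N2"
    show False
    proof (cases "N2 \<subseteq> T")
      case True
      then obtain k where k: "k \<ge> 1" "T = Rn k" using above_N2[OF T] TN by blast
      then have "k \<noteq> 1" using ne Rn_1 by auto
      then obtain n where n: "k = Suc n" "n \<ge> 1" using k(1) by (cases k) auto
      \<comment> \<open>\<open>T = Rn (n + 1)\<close> is covered by \<open>Rn n\<close>, against
        \<open>?dense\<close>.\<close>
      have R: "T \<subset> Rn n" "\<And>U. fic U \<Longrightarrow> N2 \<subseteq> U \<Longrightarrow> U \<subset> Rn n \<Longrightarrow> U \<subseteq> T"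
        using Rn_Suc_unique[OF T n(2)] k(2) n(1) by blast+
      then have "\<exists>B. fic B \<and> T \<subset> B \<and> B \<subset> Rn n" using dense fic_Rn[of n] by simp
      then obtain B where "fic B" "T \<subset> B" "B \<subset> Rn n" by (elim exE conjE)
      then show False using R(2)[of B] True by blast
    next
      case False
      then have TP: "T \<subseteq> Pn 3" using N2_subset_if_not_subset_P3[OF T c] by blast
      \<comment> \<open>\<open>Rn 4\<close> and \<open>Pn 3\<close> are incomparable, the former
        containing \<open>x^2 = x^3\<close>; they cannot both extend \<open>T\<close>.\<close>
      have "\<not> T \<subseteq> Rn 4"
      proof
        assume "T \<subseteq> Rn 4"
        then have "Rn 4 \<subseteq> Pn 3 \<or> Pn 3 \<subseteq> Rn 4"
          using chain TP fic_Rn[of 4] fic_Pn[of 3] by simp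
        then show False using sq3 P3R4 by blast
      qed
      then have "Pn 3 \<subseteq> T" using nil_theory_not_subset_Rn_iff[OF T nil_theory, of 3] by simp
      then have TP3: "T = Pn 3" using TP by blast
      \<comment> \<open>\<open>Rn 3\<close> covers \<open>Pn 3\<close>: a theory strictly above
        \<open>Pn 3\<close> and inside \<open>Rn 3\<close> would contain \<open>N2\<close>, hence be
        some \<open>Rn j\<close> with \<open>j \<le> 3\<close>.\<close>
      have "T \<subset> Rn 3" using TP3 Pn_subset_Rn sq3 by blast
      then have "\<exists>B. fic B \<and> T \<subset> B \<and> B \<subset> Rn 3" using dense fic_Rn[of 3] by simp
      then obtain B where B: "fic B" "T \<subset> B" "B \<subset> Rn 3" by (elim exE conjE)
      have "nil B c" using c B(2) unfolding nil_def by blast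
      then have "N2 \<subseteq> B" using N2_subset_if_not_subset_P3[OF B(1)] B(2) TP3 by blast
      moreover have "B \<noteq> N2" using B(2) TP3 lword_in_Rn[of 3] by auto
      ultimately obtain j where j: "B = Rn j" using above_N2[OF B(1)] by blast
      then have "j \<le> 3" using B(2) TP3 lword_in_Rn(1,3)[of 3] by auto
      then have "Rn 3 \<subseteq> B" using j Rn_antimono by simp
      then show False using B(3) by blast
    qed
  qed
qed

section \<open>Index and period\<close>

definition index_bounded :: "nat \<Rightarrow> (nat multiset \<times> nat multiset) set \<Rightarrow> bool" where
  "index_bounded n T \<longleftrightarrow> (\<forall>G. fic G \<longrightarrow> compl_reg G \<longrightarrow> \<not> T \<inter> G \<subseteq> Pn (n + 1))"

lemma index_le:
  assumes T: "fic T" and "power_id T i j" "i \<noteq> j" "i \<le> n"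
  shows "\<exists>r\<ge>1. power_id T n (n + r)"
proof (cases "i < j")
  case True
  then have "power_id T n (n + 1 * (j - i))" by (intro power_id_shift[OF T _ assms(4)]) (simp add: assms(2))
  then show ?thesis using True by (intro exI[of _ "j - i"]) simp
next
  case False
  then have "power_id T n (n + 1 * (i - j))"
    using assms(3,4) by (intro power_id_shift[OF T, of j]) (simp_all add: power_id_sym[OF T assms(2)])
  then show ?thesis using False assms(3) by (intro exI[of _ "i - j"]) simp
qed

text \<open>Take \<open>G = abelian (n + 1)\<close>. Exponents up to \<open>n\<close> are determined
  by their residues, so a short nontrivial identity of the intersection has sides of different
  lengths and yields one between powers. Conversely, periods \<open>r\<close> of \<open>T\<close>
  and \<open>c\<close> of \<open>G\<close> leave \<open>x^n = x^(n+cr)\<close> in the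
  intersection.\<close>

lemma index_bounded_iff:
  assumes T: "fic T" and n: "n \<ge> 1"
  shows "index_bounded n T \<longleftrightarrow> (\<exists>r\<ge>1. power_id T n (n + r))"
proof
  assume "index_bounded n T"
  then have "\<not> T \<inter> abelian (n + 1) \<subseteq> Pn (n + 1)"
    unfolding index_bounded_def using compl_reg_abelian[of "n + 1"] fic_abelian by simp
  then obtain s t where st: "(s, t) \<in> T" "(s, t) \<in> abelian (n + 1)" "s \<noteq> t" "size s \<le> n"
    using not_subset_Pn[OF fic_Int[OF T fic_abelian]] by blast
  have "size s \<noteq> size t"
  proof
    assume eq: "size s = size t"
    have "count s x = count t x" for x
    proof -
      have "count s x mod (n + 1) = count t x mod (n + 1)"
        using st(2) abelian_iff[of "n + 1" s t] by simp
      moreover have "count s x < n + 1" "count t x < n + 1"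
        using size_split[of s x] size_split[of t x] st(4) eq by linarith+
      ultimately show ?thesis by simp
    qed
    then show False using st(3) multiset_eqI by metis
  qed
  then show "\<exists>r\<ge>1. power_id T n (n + r)" using index_le[OF T power_id_size[OF T st(1)]] st(4) by blast
next
  assume "\<exists>r\<ge>1. power_id T n (n + r)"
  then obtain r where r: "r \<ge> 1" "power_id T n (n + r)" by blast
  show "index_bounded n T" unfolding index_bounded_def
  proof (intro allI impI notI)
    fix G assume G: "fic G" "compl_reg G" and sub: "T \<inter> G \<subseteq> Pn (n + 1)"
    obtain c where c: "c \<ge> 1" "power_id G 1 (1 + c)" using G(2) by (auto simp: compl_reg_def)
    have "power_id T n (n + c * r)" by (rule power_id_shift[OF T r(2)]) simp
    moreover have "power_id G n (n + c * r)" using power_id_shift[OF G(1) c(2) n, of r] by (simp add: mult.commute)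
    ultimately have "power_id (Pn (n + 1)) n (n + c * r)" using sub by (auto simp: power_id_def)
    then have "n = n + c * r"
      by (auto simp: power_id_def Pn_def ideal_theory_def dest: arg_cong[of _ _ size])
    then show False using c(1) r(1) by simp
  qed
qed

text \<open>Positive exponents matter only modulo \<open>c\<close>, so the common part
  \<open>a\<close> can be cancelled as in a group.\<close>

lemma compl_reg_cancel:
  assumes G: "fic G" and c: "power_id G 1 (1 + c)" "c \<ge> 1" and abelian: "power_id G (a + p * c) (b + q * c)" "a \<le> b"
  shows "power_id G 1 (1 + (b - a))"
proof -
  have ac: "a \<le> a * c" using c(2) by simp
  \<comment> \<open>\<open>a * c - a + 1\<close> complements \<open>a\<close> to a number congruent
    to 1 modulo \<open>c\<close>.\<close>
  have "power_id G (a + p * c + (a * c - a + 1)) (b + q * c + (a * c - a + 1))" by (rule power_id_add[OF G abelian(1)])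
  moreover have "a + p * c + (a * c - a + 1) = 1 + (p + a) * c"
    "b + q * c + (a * c - a + 1) = 1 + (b - a) + (q + a) * c"
    using ac abelian(2) by (simp_all add: distrib_right)
  moreover have "power_id G 1 (1 + (p + a) * c)" "power_id G (1 + (b - a)) (1 + (b - a) + (q + a) * c)"
    by (rule power_id_shift[OF G c(1)], simp)+
  ultimately show ?thesis using power_id_trans[OF G] power_id_sym[OF G] by metis
qed

section \<open>The period of a completely regular theory\<close>

definition short_period :: "nat \<Rightarrow> (nat multiset \<times> nat multiset) set \<Rightarrow> bool" where
  "short_period k G \<longleftrightarrow> (\<exists>V. fic V \<and> \<not> index_bounded k V \<and> \<not> V \<inter> G \<subseteq> Pn (k + 1))"

text \<open>The extremal \<open>V\<close> for \<open>short_period\<close>: \<open>x^k\<close> is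
  equal to no other power of \<open>x\<close>, so the index exceeds \<open>k\<close>, yet words of
  length exactly \<open>k\<close> are identified as soon as their contents agree. All longer words
  are zero.\<close>

definition same_content :: "nat \<Rightarrow> (nat multiset \<times> nat multiset) set" where
  "same_content k = {(u, v). u \<noteq> {#} \<and> v \<noteq> {#} \<and>
     (u = v \<or> k < size u \<and> k < size v \<or> size u = k \<and> size v = k \<and> set_mset u = set_mset v)}"

lemma fic_same_content: "fic (same_content k)"
proof (rule ficI)
  fix \<sigma> :: "nat \<Rightarrow> nat multiset" and s t
  assume \<sigma>: "\<And>x. \<sigma> x \<noteq> {#}" and st: "(s, t) \<in> same_content k"
  have ne: "subst_word \<sigma> s \<noteq> {#}" "subst_word \<sigma> t \<noteq> {#}"
    using st subst_word_nonempty[of \<sigma>] \<sigma> by (auto simp: same_content_def)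
  have le: "size w \<le> size (subst_word \<sigma> w)" for w by (rule size_subst_word[OF \<sigma>])
  consider "s = t" | "k < size s" "k < size t" | "size s = k" "size t = k" "set_mset s = set_mset t"
    using st by (auto simp: same_content_def)
  then show "(subst_word \<sigma> s, subst_word \<sigma> t) \<in> same_content k"
  proof cases
    case 2 then show ?thesis using ne le[of s] le[of t] by (simp add: same_content_def)
  next
    case 3
    show ?thesis
    \<comment> \<open>Both sides have the same letters: an image of length at least 2 pushes both
      beyond \<open>k\<close>, and otherwise all lengths are preserved.\<close>
    proof (cases "\<exists>x\<in>#s. size (\<sigma> x) \<ge> 2")
      case True
      have "k < size (subst_word \<sigma> w)" if w: "x \<in># w" "size (\<sigma> x) \<ge> 2" "size w = k" for w x
      proof -
        obtain w' where w': "w = add_mset x w'" using w(1) by (auto dest: multi_member_split)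
        then show ?thesis using le[of w'] w by simp
      qed
      then show ?thesis using True 3 ne by (auto simp: same_content_def)
    next
      case False
      have "size (subst_word \<sigma> w) = size w" if "\<forall>x\<in>#w. size (\<sigma> x) < 2" for w
        using that
      proof (induction w)
        case (add x w)
        have "size (\<sigma> x) \<noteq> 0" using \<sigma> by simp
        moreover have "size (\<sigma> x) < 2" using add.prems by simp
        ultimately have "size (\<sigma> x) = 1" by linarith
        then show ?case using add by simp
      qed simp
      then have "size (subst_word \<sigma> s) = k" "size (subst_word \<sigma> t) = k"
        using False 3 by (auto simp: not_le)
      then show ?thesis using 3 ne by (simp add: same_content_def set_subst_word)
    qed
  qed (use ne in \<open>simp add: same_content_def\<close>)
next
  fix s t u :: "nat multiset" assume "(s, t) \<in> same_content k" "u \<noteq> {#}"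
  then show "(s + u, t + u) \<in> same_content k"
    by (auto simp: same_content_def nonempty_has_size)
next
  fix s t u assume "(s, t) \<in> same_content k" "(t, u) \<in> same_content k"
  then show "(s, u) \<in> same_content k" by (simp add: same_content_def) (metis less_irrefl)
qed (simp_all add: same_content_def, argo)

text \<open>Index greater than \<open>k\<close> forces a short identity of \<open>V\<close> to
  preserve length and content. If a variable has exponents \<open>a < b\<close> in it, then
  \<open>1 \<le> a\<close>, and \<open>b < k\<close> because another letter occurs; so
  \<open>b - a \<le> k - 2\<close>, and cancellation in \<open>G\<close> gives
  \<open>x = x^(1+b-a)\<close>.\<close>

lemma short_period_iff:
  assumes G: "fic G" and compl_reg: "compl_reg G" and k: "k \<ge> 1"
  shows "short_period k G \<longleftrightarrow> (\<exists>d. 1 \<le> d \<and> d + 2 \<le> k \<and> power_id G 1 (1 + d))"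
proof
  assume "short_period k G"
  then obtain V where V: "fic V" "\<not> index_bounded k V" "\<not> V \<inter> G \<subseteq> Pn (k + 1)" by (auto simp: short_period_def)
  obtain c where c: "power_id G 1 (1 + c)" "c \<ge> 1" using compl_reg by (auto simp: compl_reg_def)
  obtain s t where st: "(s, t) \<in> V" "(s, t) \<in> G" "s \<noteq> t" "size s \<le> k"
    using not_subset_Pn[OF fic_Int[OF V(1) G] V(3)] by blast
  have no: "i = j" if "power_id V i j" "i \<le> k" for i j
    using index_le[OF V(1) that(1) _ that(2)] V(2) index_bounded_iff[OF V(1) k] by blast
  have size: "size s = size t" using no[OF power_id_size[OF V(1) st(1)]] st(4) by blast
  have content: "set_mset s = set_mset t"
  proof -
    have "x \<in># t" if x: "x \<in># s" for x
    proof (rule ccontr)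
      assume "x \<notin># t"
      then have "power_id V (size t) (size s + count s x)"
        using power_id_sym[OF V(1) power_id_size_count[OF V(1) st(1), of x]] by (simp add: not_in_iff)
      then have "size t = size s + count s x" by (rule no) (use size st(4) in simp)
      then show False using x size by (simp add: not_in_iff[symmetric])
    qed
    moreover have "x \<in># s" if x: "x \<in># t" for x
    proof (rule ccontr)
      assume "x \<notin># s"
      then have "power_id V (size s) (size t + count t x)"
        using power_id_size_count[OF V(1) st(1), of x] by (simp add: not_in_iff)
      then have "size s = size t + count t x" by (rule no) (rule st(4))
      then show False using x size by (simp add: not_in_iff[symmetric])
    qed
    ultimately show ?thesis by blast
  qed
  have main: "\<exists>d. 1 \<le> d \<and> d + 2 \<le> k \<and> power_id G 1 (1 + d)"
    if uv: "(u, v) \<in> G" "size u = size v" "size v \<le> k" "set_mset u = set_mset v" "count u x < count v x" for u v x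
  proof -
    have "x \<in># v" using uv(5) by (metis count_inI not_less_zero)
    then have a: "count u x \<ge> 1" using uv(4) by simp
    \<comment> \<open>If \<open>v\<close> were a power of \<open>x\<close>, so would be
      \<open>u\<close>, and equal lengths would give equal exponents.\<close>
    have b: "count v x < size v"
    proof (rule ccontr)
      assume "\<not> count v x < size v"
      then have "{#y \<in># v. y \<noteq> x#} = {#}" using size_split[of v x] by simp
      then have "{y \<in> set_mset v. y \<noteq> x} = {}" by (metis set_mset_empty set_mset_filter)
      then have "{#y \<in># u. y \<noteq> x#} = {#}" using uv(4) by (metis set_mset_eq_empty_iff set_mset_filter)
      then have "count u x = size u" using size_split[of u x] by simp
      then show False using uv(2,5) size_split[of v x] by simp
    qed
    have "power_id G 1 (1 + (count v x - count u x))"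
      by (rule compl_reg_cancel[OF G c, of _ "size {#y \<in># u. y \<noteq> x#}" _ "size {#y \<in># v. y \<noteq> x#}"])
        (use power_id_two[OF G uv(1), of 1 c x] c(2) uv(5) in simp_all)
    moreover have "1 \<le> count v x - count u x" "count v x - count u x + 2 \<le> k"
      using a b uv(3,5) by linarith+
    ultimately show ?thesis by blast
  qed
  obtain x where x: "count s x \<noteq> count t x" using st(3) by (auto simp: multiset_eq_iff)
  then show "\<exists>d. 1 \<le> d \<and> d + 2 \<le> k \<and> power_id G 1 (1 + d)"
    using main[OF st(2), of x] main[OF fic_sym[OF G st(2)], of x] size content st(4)
    by (cases "count s x < count t x") simp_all
next
  assume "\<exists>d. 1 \<le> d \<and> d + 2 \<le> k \<and> power_id G 1 (1 + d)"
  then obtain d where d: "1 \<le> d" "d + 2 \<le> k" "power_id G 1 (1 + d)" by blast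
  let ?V = "same_content k"
  \<comment> \<open>The identity \<open>x^(1+d) y^(k-d-1) = x y^(k-1)\<close>: both sides have
    length \<open>k\<close>, and \<open>d + 2 \<le> k\<close> keeps \<open>y\<close> on the
    left.\<close>
  let ?s = "replicate_mset (1 + d) (0::nat) + replicate_mset (k - d - 1) 1"
  let ?t = "replicate_mset 1 (0::nat) + replicate_mset (k - 1) 1"
  have "\<not> power_id ?V k (k + r)" if "r \<ge> 1" for r
    using that by (auto simp: power_id_def same_content_def dest: arg_cong[of _ _ size])
  then have "\<not> index_bounded k ?V" using index_bounded_iff[OF fic_same_content k] by blast
  moreover have "(?s, ?t) \<in> ?V" using d(1,2) by (auto simp: same_content_def)
  moreover have "(?s, ?t) \<in> G"
  proof (rule fic_plus[OF G])
    show "(replicate_mset (1 + d) 0, replicate_mset 1 0) \<in> G"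
      using power_id_sym[OF G d(3)] by (simp add: power_id_def)
    have "power_id G (k - d - 1) (k - d - 1 + 1 * d)" by (rule power_id_shift[OF G d(3)]) (use d in simp)
    moreover have "k - d - 1 + 1 * d = k - 1" using d by simp
    ultimately show "(replicate_mset (k - d - 1) 1, replicate_mset (k - 1) 1) \<in> G"
      using power_id_replicate[OF G] by metis
  qed
  moreover have "(?s, ?t) \<notin> Pn (k + 1)"
  proof -
    have "count ?s 0 \<noteq> count ?t 0" using d(1) by simp
    then have "?s \<noteq> ?t" by metis
    moreover have "size ?s = k" using d by simp
    ultimately show ?thesis by (simp add: Pn_def ideal_theory_def del: replicate_mset_Suc)
  qed
  ultimately show "short_period k G" unfolding short_period_def using fic_same_content by blast
qed

text \<open>Because of the shift by two in \<open>short_period_iff\<close>, the two bounds say that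
  the least period is at most \<open>m\<close> but not at most \<open>m - 1\<close>.\<close>

definition has_period :: "nat \<Rightarrow> (nat multiset \<times> nat multiset) set \<Rightarrow> bool" where
  "has_period m G \<longleftrightarrow> compl_reg G \<and> short_period (m + 2) G \<and> \<not> short_period (m + 1) G"

lemma has_period_iff:
  assumes G: "fic G" and m: "m \<ge> 1"
  shows "has_period m G \<longleftrightarrow> power_id G 1 (1 + m) \<and> (\<forall>d. 1 \<le> d \<longrightarrow> d < m \<longrightarrow> \<not> power_id G 1 (1 + d))"
proof (cases "compl_reg G")
  case True
  have "short_period (m + 2) G \<longleftrightarrow> (\<exists>d. 1 \<le> d \<and> d \<le> m \<and> power_id G 1 (1 + d))"
    "short_period (m + 1) G \<longleftrightarrow> (\<exists>d. 1 \<le> d \<and> d < m \<and> power_id G 1 (1 + d))"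
    using short_period_iff[OF G True, of "m + 2"] short_period_iff[OF G True, of "m + 1"] by auto
  then show ?thesis unfolding has_period_def using True m by (metis le_neq_implies_less order_refl)
next
  case False then show ?thesis using m unfolding has_period_def compl_reg_def by blast
qed

lemma has_period_abelian:
  assumes m: "m \<ge> 1" shows "has_period m (abelian m)"
proof -
  have "\<not> power_id (abelian m) 1 (1 + d)" if d: "1 \<le> d" "d < m" for d
  proof
    assume "power_id (abelian m) 1 (1 + d)"
    then have "(1 + d) mod m = 1 mod m" using power_id_abelian[OF m] by simp
    then have "m dvd d" by (metis add_diff_cancel_left' mod_eq_dvd_iff_nat le_add1)
    then show False using d by (simp add: nat_dvd_not_less)
  qed
  then show ?thesis using has_period_iff[OF fic_abelian m] m by (simp add: power_id_abelian mod_Suc)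
qed

text \<open>By division with remainder, \<open>m\<close> divides every \<open>d\<close> with
  \<open>x = x^(1+d)\<close>. Sending all variables but one to \<open>m\<close>-th powers and
  cancelling shows that the two exponents of that variable are congruent modulo
  \<open>m\<close>.\<close>

lemma has_period_subset_abelian:
  assumes G: "fic G" and m: "m \<ge> 1" and P: "has_period m G" shows "G \<subseteq> abelian m"
proof (rule subrelI)
  fix s t assume st: "(s, t) \<in> G"
  have p: "power_id G 1 (1 + m)" and least: "\<And>d. 1 \<le> d \<Longrightarrow> d < m \<Longrightarrow> \<not> power_id G 1 (1 + d)"
    using P has_period_iff[OF G m] by blast+
  have dvd: "d mod m = 0" if "power_id G 1 (1 + d)" for d
  proof -
    have "power_id G (1 + d mod m) (1 + d mod m + d div m * m)" by (rule power_id_shift[OF G p]) simp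
    then have "power_id G 1 (1 + d mod m)" using power_id_trans[OF G that power_id_sym[OF G]] by simp
    then show ?thesis using least[of "d mod m"] m by (cases "d mod m = 0") auto
  qed
  have *: "count u x mod m = count v x mod m" if uv: "(u, v) \<in> G" "count u x \<le> count v x" for u v x
  proof -
    have "power_id G 1 (1 + (count v x - count u x))"
      by (rule compl_reg_cancel[OF G p m, of _ "size {#y \<in># u. y \<noteq> x#}" _ "size {#y \<in># v. y \<noteq> x#}"])
        (use power_id_two[OF G uv(1), of 1 m x] m uv(2) in simp_all)
    then have "(count v x - count u x) mod m = 0" by (rule dvd)
    then show ?thesis using uv(2) by (metis mod_eq_dvd_iff_nat dvd_eq_mod_eq_0)
  qed
  have "count s x mod m = count t x mod m" for x
  proof (cases "count s x \<le> count t x")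
    case True then show ?thesis by (rule *[OF st])
  next
    case False then show ?thesis using *[OF fic_sym[OF G st], of x] by simp
  qed
  then show "(s, t) \<in> abelian m" using abelian_iff[OF m] fic_ne[OF G st] by simp
qed

definition index_period :: "nat \<Rightarrow> nat \<Rightarrow> (nat multiset \<times> nat multiset) set \<Rightarrow> bool" where
  "index_period n m T \<longleftrightarrow> index_bounded n T \<and> (\<forall>U. fic U \<longrightarrow> T \<subseteq> U \<longrightarrow> compl_reg U \<longrightarrow> (\<exists>W. fic W \<and> has_period m W \<and> W \<subseteq> U))"

text \<open>\<open>W\<close> has exact period \<open>m\<close>, so \<open>W \<subseteq> U\<close>
  gives \<open>x = x^(1+m)\<close> in \<open>U\<close>. For a completely regular root of
  \<open>T\<close> this is an identity of \<open>T\<close> between high powers, brought down to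
  exponent \<open>n\<close> by periodicity.\<close>

lemma index_period_iff:
  assumes T: "fic T" and n: "n \<ge> 1" and m: "m \<ge> 1"
  shows "index_period n m T \<longleftrightarrow> power_id T n (n + m)"
proof
  assume L: "index_period n m T"
  then obtain r where r: "r \<ge> 1" "power_id T n (n + r)" using index_bounded_iff[OF T n] by (auto simp: index_period_def)
  \<comment> \<open>At least \<open>n\<close>, and congruent to 1 modulo \<open>r\<close>, so that
    \<open>c * m\<close> and \<open>m\<close> agree modulo \<open>r\<close>.\<close>
  define c where "c = n * r + 1"
  have "n \<le> n * r" using r(1) by simp
  then have c: "c \<ge> 1" "n \<le> c" unfolding c_def by linarith+
  have "power_id (root c T) 1 (1 + r)"
    using power_id_shift[OF T r(2) c(2), of c] by (simp add: power_id_root)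
  then have "compl_reg (root c T)" using r(1) by (auto simp: compl_reg_def)
  then obtain W where W: "fic W" "has_period m W" "W \<subseteq> root c T"
    using L fic_root[OF T c(1)] unfolding index_period_def by blast
  then have "power_id W 1 (1 + m)" using has_period_iff[OF W(1) m] by blast
  then have "power_id T c (c + c * m)" using W(3) power_id_root[of c T 1 "1 + m"] by (auto simp: power_id_def)
  moreover have "power_id T (c + m) (c + m + n * m * r)" by (rule power_id_shift[OF T r(2)]) (use c in simp)
  moreover have "c + m + n * m * r = c + c * m" by (simp add: c_def algebra_simps)
  ultimately have "power_id T c (c + m)" using power_id_trans[OF T] power_id_sym[OF T] by metis
  \<comment> \<open>The exponent \<open>n + n * r\<close> is at least \<open>c\<close> and differs
    from \<open>n\<close> by a multiple of \<open>r\<close>.\<close>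
  then have "power_id T (n + n * r) (n + n * r + 1 * m)" by (rule power_id_shift[OF T]) (use n in \<open>simp add: c_def\<close>)
  moreover have "power_id T n (n + n * r)" "power_id T (n + m) (n + m + n * r)"
    by (rule power_id_shift[OF T r(2)], simp)+
  moreover have "n + n * r + 1 * m = n + m + n * r" by simp
  ultimately show "power_id T n (n + m)" using power_id_trans[OF T] power_id_sym[OF T] by metis
next
  assume R: "power_id T n (n + m)"
  have "\<exists>W. fic W \<and> has_period m W \<and> W \<subseteq> U" if U: "fic U" "T \<subseteq> U" "compl_reg U" for U
  proof -
    obtain c where c: "c \<ge> 1" "power_id U 1 (1 + c)" using U(3) by (auto simp: compl_reg_def)
    have "power_id U n (n + m)" using R U(2) by (auto simp: power_id_def)
    then have "power_id U 1 (1 + (n + m - n))"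
      by (intro compl_reg_cancel[OF U(1) c(2,1), of n 0 "n + m" 0]) simp_all
    moreover have "power_id (abelian m) 1 (1 + m)" "\<forall>d. 1 \<le> d \<longrightarrow> d < m \<longrightarrow> \<not> power_id (abelian m) 1 (1 + d)"
      using has_period_abelian[OF m] has_period_iff[OF fic_abelian m] by blast+
    \<comment> \<open>Intersecting with \<open>abelian m\<close> removes any shorter period that
      \<open>U\<close> may have.\<close>
    ultimately have "has_period m (U \<inter> abelian m)"
      using has_period_iff[OF fic_Int[OF U(1) fic_abelian] m] by (simp add: power_id_def)
    then show ?thesis using fic_Int[OF U(1) fic_abelian] by blast
  qed
  then show "index_period n m T" unfolding index_period_def using index_bounded_iff[OF T n] R m by blast
qed

section \<open>The theory of a commutative monoid\<close>

text \<open>Setting all variables but one to the unit isolates the exponents of that variable.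
  Conversely, replacing the powers of one variable after another preserves the value of the
  product.\<close>

lemma variety_generated_iff:
  "(s, t) \<in> variety_generated TYPE('a::comm_monoid_mult) \<longleftrightarrow>
     s \<noteq> {#} \<and> t \<noteq> {#} \<and> (\<forall>x (a::'a). a ^ count s x = a ^ count t x)"
proof -
  have "(\<forall>v::nat \<Rightarrow> 'a. prod_mset (image_mset v s) = prod_mset (image_mset v t)) \<longleftrightarrow>
    (\<forall>x (a::'a). a ^ count s x = a ^ count t x)" (is "?L \<longleftrightarrow> ?R")
  proof
    assume L: ?L
    show ?R
    proof (intro allI)
      fix x :: nat and a :: 'a
      have "prod_mset (image_mset (\<lambda>y. if y = x then a else 1) w) = a ^ count w x" for w
        by (induction w) auto
      then show "a ^ count s x = a ^ count t x" using L by metis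
    qed
  next
    assume R: ?R
    show ?L
    proof
      fix v :: "nat \<Rightarrow> 'a"
      show "prod_mset (image_mset v s) = prod_mset (image_mset v t)"
      proof (rule pointwise_congruence[of "\<lambda>s t. prod_mset (image_mset v s) = prod_mset (image_mset v t)"])
        fix x
        have "prod_mset (image_mset v (replicate_mset k x)) = v x ^ k" for k
          by (induction k) auto
        then show "prod_mset (image_mset v (replicate_mset (count s x) x)) =
            prod_mset (image_mset v (replicate_mset (count t x) x))" using R by simp
      qed simp_all
    qed
  qed
  then show ?thesis by (simp add: variety_generated_def cwords_def)
qed

lemma fic_variety_generated: "fic (variety_generated TYPE('a::comm_monoid_mult))"
proof (rule ficI)
  fix \<sigma> :: "nat \<Rightarrow> nat multiset" and s t
  assume \<sigma>: "\<And>x. \<sigma> x \<noteq> {#}" and st: "(s, t) \<in> variety_generated TYPE('a)"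
  have *: "prod_mset (image_mset v (subst_word \<sigma> w)) =
      prod_mset (image_mset (\<lambda>x. prod_mset (image_mset v (\<sigma> x))) w)" for w and v :: "nat \<Rightarrow> 'a"
    by (induction w) simp_all
  show "(subst_word \<sigma> s, subst_word \<sigma> t) \<in> variety_generated TYPE('a)"
    using st subst_word_nonempty[of \<sigma>] \<sigma> by (auto simp: variety_generated_def cwords_def *)
qed (auto simp: variety_generated_def cwords_def)

lemma power_id_variety_generated:
  "power_id (variety_generated TYPE('a::comm_monoid_mult)) i j \<longleftrightarrow>
     i \<ge> 1 \<and> j \<ge> 1 \<and> (\<forall>a::'a. a ^ i = a ^ j)"
  by (auto simp: power_id_def variety_generated_iff)

text \<open>The exponents that all elements identify form a congruence on the additive monoid of
  naturals: equality, or one with an index \<open>n\<close> and a period \<open>m\<close>. The index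
  0 occurs for groups, where \<open>a^m = 1\<close>.\<close>

lemma monoid_index_period:
  obtains (free) "\<And>i j. (\<forall>a::'a::comm_monoid_mult. a ^ i = a ^ j) \<Longrightarrow> i = j"
  | (periodic) n m where "m \<ge> 1"
    "\<And>i j. (\<forall>a::'a. a ^ i = a ^ j) \<longleftrightarrow> i = j \<or> n \<le> i \<and> n \<le> j \<and> i mod m = j mod m"
proof (cases "\<forall>i j. (\<forall>a::'a. a ^ i = a ^ j) \<longrightarrow> i = j")
  case True then show ?thesis using free by blast
next
  case False
  define E where "E i j \<longleftrightarrow> (\<forall>a::'a. a ^ i = a ^ j)" for i j
  have E_sym: "E i j \<Longrightarrow> E j i" for i j by (simp add: E_def)
  have E_trans: "E i j \<Longrightarrow> E j k \<Longrightarrow> E i k" for i j k by (simp add: E_def)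
  have E_add: "E i j \<Longrightarrow> E (i + k) (j + k)" for i j k by (simp add: E_def power_add)
  have "\<exists>n r. r \<ge> 1 \<and> E n (n + r)"
  proof -
    obtain i j where ij: "E i j" "i \<noteq> j" using False by (auto simp: E_def)
    have "E (min i j) (min i j + (max i j - min i j))" using ij E_sym by (auto simp: min_def max_def)
    moreover have "max i j - min i j \<ge> 1" using ij(2) by (auto simp: min_def max_def)
    ultimately show ?thesis by blast
  qed
  then have "\<exists>r\<ge>1. E (LEAST n. \<exists>r\<ge>1. E n (n + r)) ((LEAST n. \<exists>r\<ge>1. E n (n + r)) + r)"
    by (rule LeastI_ex)
  define n where "n = (LEAST n. \<exists>r\<ge>1. E n (n + r))"
  have n: "\<exists>r\<ge>1. E n (n + r)" unfolding n_def by fact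
  have n_le: "n \<le> i" if "r \<ge> 1" "E i (i + r)" for i r
    unfolding n_def by (rule Least_le) (use that in blast)
  define m where "m = (LEAST r. r \<ge> 1 \<and> E n (n + r))"
  have m: "m \<ge> 1" "E n (n + m)" using LeastI_ex[OF n] by (auto simp: m_def)
  have m_le: "m \<le> r" if "r \<ge> 1" "E n (n + r)" for r
    unfolding m_def by (rule Least_le) (use that in simp)
  have shift: "E i (i + q * m)" if "n \<le> i" for i q
  proof (induction q)
    case 0 then show ?case by (simp add: E_def)
  next
    case (Suc q)
    have "E (n + (i - n + q * m)) (n + m + (i - n + q * m))" by (rule E_add[OF m(2)])
    then have "E (i + q * m) (i + Suc q * m)" using that by (simp add: algebra_simps)
    then show ?case using Suc E_trans by blast
  qed
  have up: "n \<le> i \<and> d mod m = 0" if "E i (i + d)" "d \<ge> 1" for i d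
  proof -
    have ni: "n \<le> i" using n_le that by blast
    have im: "i \<le> i * m" using m(1) by simp
    \<comment> \<open>The added exponent carries \<open>i\<close> to \<open>n + i * m\<close>, which
      \<open>shift\<close> takes back to \<open>n\<close>, where \<open>m\<close> is
      minimal.\<close>
    have "E (i + (n + i * m - i)) (i + d + (n + i * m - i))" by (rule E_add[OF that(1)])
    then have "E (n + i * m) (n + d + i * m)" using im by (simp add: algebra_simps)
    then have "E n (n + d)" using shift[of n i] shift[of "n + d" i] E_trans E_sym by (meson le_add1 order_refl)
    moreover have "E (n + d mod m) (n + d mod m + d div m * m)" by (rule shift) simp
    moreover have "n + d mod m + d div m * m = n + d" by simp
    ultimately have "E n (n + d mod m)" using E_trans E_sym by metis
    then have "d mod m = 0" using m_le[of "d mod m"] m(1) by (metis Suc_le_eq One_nat_def gr0I mod_less_divisor not_le)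
    then show ?thesis using ni by simp
  qed
  have "E i j \<longleftrightarrow> i = j \<or> n \<le> i \<and> n \<le> j \<and> i mod m = j mod m" if "i \<le> j" for i j
  proof
    assume "E i j"
    then have "i = j \<or> n \<le> i \<and> (j - i) mod m = 0"
      using up[of i "j - i"] that by (cases "i = j") auto
    then show "i = j \<or> n \<le> i \<and> n \<le> j \<and> i mod m = j mod m"
      using that mod_eq_dvd_iff_nat[of i j m] by (auto simp: dvd_eq_mod_eq_0)
  next
    assume "i = j \<or> n \<le> i \<and> n \<le> j \<and> i mod m = j mod m"
    then show "E i j"
    proof
      assume a: "n \<le> i \<and> n \<le> j \<and> i mod m = j mod m"
      then have "m dvd j - i" using that mod_eq_dvd_iff_nat[of i j m] by simp
      then obtain q where "j - i = m * q" by (auto simp: dvd_def)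
      then have "j = i + q * m" using that by (metis le_add_diff_inverse mult.commute)
      then show ?thesis using shift a by simp
    qed (simp add: E_def)
  qed
  then have "E i j \<longleftrightarrow> i = j \<or> n \<le> i \<and> n \<le> j \<and> i mod m = j mod m" for i j
    using E_sym[of i j] E_sym[of j i] by (metis nle_le)
  then show ?thesis using periodic m(1) unfolding E_def by blast
qed

lemma fic_contains_power_theory:
  assumes T: "fic T" and p: "power_id T n (n + m)" and ne: "s \<noteq> {#}"
    and c: "\<And>x. count s x = count t x \<or>
      n \<le> count s x \<and> n \<le> count t x \<and> count s x mod m = count t x mod m"
  shows "(s, t) \<in> T"
proof -
  have "s = t \<or> (s, t) \<in> T"
  \<comment> \<open>Exponents may be 0 and the empty word belongs to no theory, hence the
    alternative \<open>u = v\<close>.\<close>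
  proof (rule pointwise_congruence[of "\<lambda>u v. u = v \<or> (u, v) \<in> T"])
    fix x
    have le: "power_id T i j" if "n \<le> i" "i \<le> j" "i mod m = j mod m" for i j
    proof -
      have "m dvd j - i" using that mod_eq_dvd_iff_nat[of i j m] by simp
      then obtain q where "j - i = m * q" by (auto simp: dvd_def)
      then have "j = i + q * m" using that by (metis le_add_diff_inverse mult.commute)
      then show ?thesis using power_id_shift[OF T p that(1)] by simp
    qed
    have "power_id T i j" if ij: "n \<le> i" "n \<le> j" "i mod m = j mod m" for i j
    proof (cases "i \<le> j")
      case True show ?thesis by (rule le[OF ij(1) True ij(3)])
    next
      case False
      then have "j \<le> i" by simp
      then show ?thesis by (rule power_id_sym[OF T le[OF ij(2) _ ij(3)[symmetric]]])
    qed
    then show "replicate_mset (count s x) x = replicate_mset (count t x) x \<or>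
        (replicate_mset (count s x) x, replicate_mset (count t x) x) \<in> T"
      using c[of x] power_id_replicate[OF T] by metis
  qed (use fic_trans[OF T] fic_add_left[OF T] in auto)
  then show ?thesis using fic_refl[OF T ne] by auto
qed

section \<open>Formulas\<close>

text \<open>Below, \<open>X_f i\<close> expresses \<open>X\<close> of the variable \<open>i\<close> and binds only variables above \<open>i\<close>.
  The first argument of \<open>R_f\<close> is shifted by one: \<open>R_f n\<close> describes \<open>Rn (n + 1)\<close>.\<close>

abbreviation holds where "holds \<equiv> sat Com Com_join Com_meet"

definition imp_f :: "lform \<Rightarrow> lform \<Rightarrow> lform" where
  "imp_f f g = LOr (LNot f) g"

text \<open>The order of varieties recovered from the join. On theories it is reverse inclusion, so
  formulas read upside down compared with the lemmas above.\<close>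

definition le_f :: "nat \<Rightarrow> nat \<Rightarrow> lform" where
  "le_f i j = LEq (LJoin (LVar i) (LVar j)) (LVar j)"

definition lt_f :: "nat \<Rightarrow> nat \<Rightarrow> lform" where
  "lt_f i j = LAnd (le_f i j) (LNot (le_f j i))"

definition le_join_f :: "nat \<Rightarrow> nat \<Rightarrow> nat \<Rightarrow> lform" where
  "le_join_f p i j = LEq (LJoin (LVar p) (LJoin (LVar i) (LVar j))) (LJoin (LVar i) (LVar j))"

lemma holds_basic [simp]:
  "holds e (imp_f f g) \<longleftrightarrow> (holds e f \<longrightarrow> holds e g)"
  "holds e (le_f i j) \<longleftrightarrow> e j \<subseteq> e i"
  "holds e (lt_f i j) \<longleftrightarrow> e j \<subset> e i"
  "holds e (le_join_f p i j) \<longleftrightarrow> e i \<inter> e j \<subseteq> e p"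
  by (auto simp: imp_f_def le_f_def lt_f_def le_join_f_def Com_join_def)

lemma fvars_basic [simp]:
  "fvars (imp_f f g) = fvars f \<union> fvars g" "fvars (le_f i j) = {i, j}" "fvars (lt_f i j) = {i, j}"
  "fvars (le_join_f p i j) = {p, i, j}"
  by (auto simp: imp_f_def le_f_def lt_f_def le_join_f_def)

lemma Com_iff [simp]: "T \<in> Com \<longleftrightarrow> fic T"
  by (simp add: Com_def)

definition bot_f :: "nat \<Rightarrow> lform" where
  "bot_f i = LAll (i + 1) (le_f i (i + 1))"

lemma holds_bot_f [simp]: "fic (e i) \<Longrightarrow> holds e (bot_f i) \<longleftrightarrow> e i = cwords \<times> cwords"
proof -
  assume e: "fic (e i)"
  have "holds e (bot_f i) \<longleftrightarrow> (\<forall>T\<in>Com. T \<subseteq> e i)" by (simp add: bot_f_def)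
  also have "\<dots> \<longleftrightarrow> e i = cwords \<times> cwords"
    using e fic_full fic_subset_full unfolding Com_iff Ball_def by (metis subset_antisym)
  finally show ?thesis .
qed

lemma fvars_bot_f [simp]: "fvars (bot_f i) = {i}"
  by (auto simp: bot_f_def)

definition N2_f :: "nat \<Rightarrow> lform" where
  "N2_f i = LAnd (LNot (bot_f i)) (LAnd
     (LAll (i + 1) (imp_f (le_f (i + 1) i) (LAll (i + 2) (imp_f (le_f (i + 2) i)
        (LOr (le_f (i + 2) (i + 1)) (le_f (i + 1) (i + 2)))))))
     (LAll (i + 1) (imp_f (lt_f (i + 1) i) (LEx (i + 2) (LAnd (lt_f (i + 2) i) (lt_f (i + 1) (i + 2)))))))"

lemma holds_N2_f [simp]: "fic (e i) \<Longrightarrow> holds e (N2_f i) \<longleftrightarrow> e i = N2"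
  unfolding N2_unique by (simp add: N2_f_def Ball_def Bex_def)

lemma fvars_N2_f [simp]: "fvars (N2_f i) = {i}"
  by (auto simp: N2_f_def)

text \<open>Transcribes \<open>Rn_Suc_unique\<close>: variable \<open>i + 1\<close> holds
  \<open>N2\<close>, \<open>i + 2\<close> the preceding member of the chain, and
  \<open>i + 3\<close> ranges over the competitors.\<close>

fun R_f :: "nat \<Rightarrow> nat \<Rightarrow> lform" where
  "R_f 0 i = bot_f i"
| "R_f (Suc n) i = LEx (i + 1) (LAnd (N2_f (i + 1)) (LAnd (le_f i (i + 1))
     (LEx (i + 2) (LAnd (R_f n (i + 2)) (LAnd (lt_f (i + 2) i)
       (LAll (i + 3) (imp_f (LAnd (le_f (i + 3) (i + 1)) (lt_f (i + 2) (i + 3))) (le_f i (i + 3)))))))))"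

lemma holds_R_f [simp]: "fic (e i) \<Longrightarrow> holds e (R_f n i) \<longleftrightarrow> e i = Rn (n + 1)"
proof (induction n arbitrary: e i)
  case 0 then show ?case using Rn_1 by simp
next
  case (Suc n)
  show ?case
    unfolding R_f.simps using Suc.prems fic_N2 fic_Rn
    by (simp add: Suc.IH Rn_Suc_unique[of "e i" "Suc n"] Ball_def Bex_def cong: conj_cong) blast
qed

lemma fvars_R_f [simp]: "fvars (R_f n i) = {i}"
  by (induction n arbitrary: i) auto

declare R_f.simps [simp del]

definition compl_reg_f :: "nat \<Rightarrow> lform" where
  "compl_reg_f i = LAll (i + 1) (imp_f (R_f 1 (i + 1)) (LNot (le_f (i + 1) i)))"

lemma holds_compl_reg_f [simp]: "fic (e i) \<Longrightarrow> holds e (compl_reg_f i) \<longleftrightarrow> compl_reg (e i)"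
  using fic_Rn[of 2] by (auto simp: compl_reg_f_def compl_reg_iff numeral_2_eq_2)

lemma fvars_compl_reg_f [simp]: "fvars (compl_reg_f i) = {i}"
  by (auto simp: compl_reg_f_def)

definition nil_theory_f :: "nat \<Rightarrow> lform" where
  "nil_theory_f i = LAll (i + 1) (imp_f (LAnd (le_f (i + 1) i) (compl_reg_f (i + 1))) (bot_f (i + 1)))"

lemma holds_nil_theory_f [simp]: "fic (e i) \<Longrightarrow> holds e (nil_theory_f i) \<longleftrightarrow> nil_theory (e i)"
  by (auto simp: nil_theory_f_def nil_theory_def)

lemma fvars_nil_theory_f [simp]: "fvars (nil_theory_f i) = {i}"
  by (auto simp: nil_theory_f_def)

definition not_above_R_f :: "nat \<Rightarrow> nat \<Rightarrow> lform" where
  "not_above_R_f k i = LAll (i + 1) (imp_f (R_f k (i + 1)) (LNot (le_f (i + 1) i)))"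

lemma holds_not_above_R_f [simp]: "fic (e i) \<Longrightarrow> holds e (not_above_R_f k i) \<longleftrightarrow> \<not> e i \<subseteq> Rn (k + 1)"
  using fic_Rn[of "k + 1"] by (auto simp: not_above_R_f_def)

lemma fvars_not_above_R_f [simp]: "fvars (not_above_R_f k i) = {i}"
  by (auto simp: not_above_R_f_def)

definition P_f :: "nat \<Rightarrow> nat \<Rightarrow> lform" where
  "P_f k i = LAnd (nil_theory_f i) (LAnd (not_above_R_f k i)
     (LAll (i + 1) (imp_f (LAnd (nil_theory_f (i + 1)) (not_above_R_f k (i + 1))) (le_f (i + 1) i))))"

lemma holds_P_f [simp]: "fic (e i) \<Longrightarrow> k \<ge> 1 \<Longrightarrow> holds e (P_f k i) \<longleftrightarrow> e i = Pn k"
  unfolding Pn_unique by (auto simp: P_f_def)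

lemma fvars_P_f [simp]: "fvars (P_f k i) = {i}"
  by (auto simp: P_f_def)

definition index_bounded_f :: "nat \<Rightarrow> nat \<Rightarrow> lform" where
  "index_bounded_f k i = LAll (i + 1) (imp_f (P_f (k + 1) (i + 1))
     (LAll (i + 2) (imp_f (compl_reg_f (i + 2)) (LNot (le_join_f (i + 1) i (i + 2))))))"

lemma holds_index_bounded_f [simp]: "fic (e i) \<Longrightarrow> holds e (index_bounded_f k i) \<longleftrightarrow> index_bounded k (e i)"
  using fic_Pn[of "k + 1"] by (auto simp: index_bounded_f_def index_bounded_def)

lemma fvars_index_bounded_f [simp]: "fvars (index_bounded_f k i) = {i}"
  by (auto simp: index_bounded_f_def)

definition short_period_f :: "nat \<Rightarrow> nat \<Rightarrow> lform" where
  "short_period_f k i = LEx (i + 1) (LAnd (LNot (index_bounded_f k (i + 1)))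
     (LEx (i + 2) (LAnd (P_f (k + 1) (i + 2)) (LNot (le_join_f (i + 2) (i + 1) i)))))"

lemma holds_short_period_f [simp]: "fic (e i) \<Longrightarrow> holds e (short_period_f k i) \<longleftrightarrow> short_period k (e i)"
  using fic_Pn[of "k + 1"] by (auto simp: short_period_f_def short_period_def)

lemma fvars_short_period_f [simp]: "fvars (short_period_f k i) = {i}"
  by (auto simp: short_period_f_def)

definition has_period_f :: "nat \<Rightarrow> nat \<Rightarrow> lform" where
  "has_period_f m i = LAnd (compl_reg_f i) (LAnd (short_period_f (m + 2) i) (LNot (short_period_f (m + 1) i)))"

lemma holds_has_period_f [simp]: "fic (e i) \<Longrightarrow> holds e (has_period_f m i) \<longleftrightarrow> has_period m (e i)"
  by (simp add: has_period_f_def has_period_def)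

lemma fvars_has_period_f [simp]: "fvars (has_period_f m i) = {i}"
  by (simp add: has_period_f_def)

definition index_period_f :: "nat \<Rightarrow> nat \<Rightarrow> nat \<Rightarrow> lform" where
  "index_period_f n m i = LAnd (index_bounded_f n i) (LAll (i + 1) (imp_f (LAnd (le_f (i + 1) i) (compl_reg_f (i + 1)))
     (LEx (i + 2) (LAnd (has_period_f m (i + 2)) (le_f (i + 1) (i + 2))))))"

lemma holds_index_period_f [simp]: "fic (e i) \<Longrightarrow> holds e (index_period_f n m i) \<longleftrightarrow> index_period n m (e i)"
  by (auto simp: index_period_f_def index_period_def Ball_def Bex_def)

lemma fvars_index_period_f [simp]: "fvars (index_period_f n m i) = {i}"
  by (auto simp: index_period_f_def)

lemma definable_singletonI:
  assumes "fvars \<Phi> \<subseteq> {0}" "\<And>T. fic T \<Longrightarrow> holds (\<lambda>_. T) \<Phi> \<longleftrightarrow> T = V"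
  shows "definable Com Com_join Com_meet {V}"
  unfolding definable_def using assms by (intro exI[of _ \<Phi>]) simp

theorem mainTheorem1:
  shows "definable Com Com_join Com_meet {variety_generated TYPE('a::comm_monoid_mult)}"
proof -
  let ?V = "variety_generated TYPE('a)"
  have V: "fic ?V" by (rule fic_variety_generated)
  show ?thesis
  proof (rule monoid_index_period[where 'a = 'a])
    assume free: "\<And>i j. (\<forall>a::'a. a ^ i = a ^ j) \<Longrightarrow> i = j"
    \<comment> \<open>Only trivial identities hold, so the variety is the greatest element of the
      lattice.\<close>
    have "s = t" if "(s, t) \<in> ?V" for s t
      using that free by (auto simp: variety_generated_iff intro: multiset_eqI)
    then have least: "?V \<subseteq> T" if "fic T" for T
      using fic_refl[OF that] fic_ne[OF V] by (metis subrelI)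
    show ?thesis
    proof (rule definable_singletonI)
      show "fvars (LAll 1 (le_f 1 0)) \<subseteq> {0}" by auto
      fix T assume "fic T"
      then show "holds (\<lambda>_. T) (LAll 1 (le_f 1 0)) \<longleftrightarrow> T = ?V"
        using least V by (simp add: Ball_def) (metis subset_antisym)
    qed
  next
    fix n m assume m: "m \<ge> 1" and
      E: "\<And>i j. (\<forall>a::'a. a ^ i = a ^ j) \<longleftrightarrow> i = j \<or> n \<le> i \<and> n \<le> j \<and> i mod m = j mod m"
    have Viff: "(s, t) \<in> ?V \<longleftrightarrow> s \<noteq> {#} \<and> t \<noteq> {#} \<and> (\<forall>x. count s x = count t x \<or>
      n \<le> count s x \<and> n \<le> count t x \<and> count s x mod m = count t x mod m)" for s t
      using variety_generated_iff[where 'a = 'a] E by simp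
    show ?thesis
    proof (cases "n = 0")
      case True
      have "(s, t) \<in> ?V \<longleftrightarrow> (s, t) \<in> abelian m" for s t
        unfolding Viff abelian_iff[OF m] using True by simp metis
      then have Vab: "?V = abelian m" by auto
      \<comment> \<open>\<open>abelian m\<close> is the largest theory of period \<open>m\<close>,
        so its variety is the least one.\<close>
      let ?\<Phi> = "LAnd (has_period_f m 0) (LAll 1 (imp_f (has_period_f m 1) (le_f 0 1)))"
      show ?thesis
      proof (rule definable_singletonI)
        show "fvars ?\<Phi> \<subseteq> {0}" by auto
        fix T assume T: "fic T"
        have "holds (\<lambda>_. T) ?\<Phi> \<longleftrightarrow> has_period m T \<and> (\<forall>U. fic U \<longrightarrow> has_period m U \<longrightarrow> U \<subseteq> T)"
          using T by auto
        also have "\<dots> \<longleftrightarrow> T = abelian m"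
        proof
          assume "has_period m T \<and> (\<forall>U. fic U \<longrightarrow> has_period m U \<longrightarrow> U \<subseteq> T)"
          then show "T = abelian m" using has_period_subset_abelian[OF T m] has_period_abelian[OF m] fic_abelian[of m]
            by (metis subset_antisym)
        next
          assume "T = abelian m"
          then show "has_period m T \<and> (\<forall>U. fic U \<longrightarrow> has_period m U \<longrightarrow> U \<subseteq> T)"
            using has_period_subset_abelian[OF _ m] has_period_abelian[OF m] by simp
        qed
        finally show "holds (\<lambda>_. T) ?\<Phi> \<longleftrightarrow> T = ?V" using Vab by simp
      qed
    next
      case False
      then have n: "n \<ge> 1" by simp
      have pV: "power_id ?V n (n + m)" using n by (simp add: power_id_variety_generated E)
      have least: "?V \<subseteq> T" if T: "fic T" "power_id T n (n + m)" for T
        using fic_contains_power_theory[OF T] Viff by auto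
      \<comment> \<open>In contrast to the group case, \<open>?V\<close> is the least theory with
        \<open>x^n = x^(n+m)\<close>, so the formula asks for the greatest variety.\<close>
      let ?\<Phi> = "LAnd (index_period_f n m 0) (LAll 1 (imp_f (index_period_f n m 1) (le_f 1 0)))"
      show ?thesis
      proof (rule definable_singletonI)
        show "fvars ?\<Phi> \<subseteq> {0}" by auto
        fix T assume T: "fic T"
        have "holds (\<lambda>_. T) ?\<Phi> \<longleftrightarrow> index_period n m T \<and> (\<forall>U. fic U \<longrightarrow> index_period n m U \<longrightarrow> T \<subseteq> U)"
          using T by auto
        also have "\<dots> \<longleftrightarrow> power_id T n (n + m) \<and> (\<forall>U. fic U \<longrightarrow> power_id U n (n + m) \<longrightarrow> T \<subseteq> U)"
          using index_period_iff[OF _ n m] T by simp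
        also have "\<dots> \<longleftrightarrow> T = ?V" using least pV V T by (metis subset_antisym)
        finally show "holds (\<lambda>_. T) ?\<Phi> \<longleftrightarrow> T = ?V" .
      qed
    qed
  qed
qed

end
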